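(* Let $p,q\ge0$, $s\in\mathcal{Y}_p$, $t\in\mathcal{Y}_q$ and $r\in\mathcal{Y}_{p+q}$. In $\mathcal{Y}Sym$, the coefficient of $M_r$ in the product $M_s\cdot M_t$ equals the number of $\zeta\in\mathfrak{S}^{(p,q)}$ such that the set $\{(s',t')\in\mathcal{Y}_p\times\mathcal{Y}_q : f_\zeta(s',t')\le r\}$ has a maximum element (for the product of Tamari orders) and this maximum equals $(s,t)$.
   Context: Permutations are in one-line notation; products are compositions of functions. $\mathrm{st}(a_1,\dots,a_p)\in\mathfrak{S}_p$ is the permutation with the same relative order as distinct integers $a_1,\dots,a_p$. For $\sigma\in\mathfrak{S}_p,\tau\in\mathfrak{S}_q$: $\sigma\vee\tau\in\mathfrak{S}_{p+q+1}$ is $\sigma(1)+q,\dots,\sigma(p)+q,p+q+1,\tau(1),\dots,\tau(q)$ and $\sigma/\tau\in\mathfrak{S}_{p+q}$ is $\sigma(1),\dots,\sigma(p),\tau(1)+p,\dots,\tau(q)+p$. $\mathfrak{S}^{(p,q)}$ is the set of $\zeta\in\mathfrak{S}_{p+q}$ with at most one descent, at position $p$ (i.e. $\zeta(i)>\zeta(i+1)$ implies $i=p$). Trees: $\mathcal{Y}_n$ is the set of rooted planar binary trees with $n$ internal nodes; $\mathcal{Y}_0=\{|\}$; $s\vee t$ is the tree with left subtree $s$ and right subtree $t$ at its root, each $t\neq|$ is uniquely $t_l\vee t_r$. Tamari order: generated by replacing a subtree $(a\vee b)\vee c$ by the larger $a\vee(b\vee c)$. $\lambda:\mathfrak{S}_n\to\mathcal{Y}_n$: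 $\lambda(\mathrm{id}_0)=|$, and for $j=\sigma^{-1}(n)$, $\lambda(\sigma)=\lambda(\mathrm{st}(\sigma(1),\dots,\sigma(j-1)))\vee\lambda(\mathrm{st}(\sigma(j+1),\dots,\sigma(n)))$. $\gamma:\mathcal{Y}_n\to\mathfrak{S}_n$: $\gamma(|)=\mathrm{id}_0$, $\gamma(t)=\gamma(t_l)\vee\gamma(t_r)$. For $\zeta\in\mathfrak{S}^{(p,q)}$, $f_\zeta:\mathcal{Y}_p\times\mathcal{Y}_q\to\mathcal{Y}_{p+q}$ is $f_\zeta(s,t)=\lambda\big((\gamma(s)/\gamma(t))\cdot\zeta^{-1}\big)$. $\mathcal{Y}Sym$: graded Hopf algebra over $\mathbb{Q}$ with basis $F_t$. Leaves of $t\in\mathcal{Y}_p$ are numbered $0,\dots,p$. Splitting $t$ at leaf $i$, $t\to(t_0,t_1)$: $|\to(|,|)$; for $t=t_l\vee t_r$, if leaf $i$ is in $t_l$ and $t_l\to(a,b)$ there, then $t\to(a,b\vee t_r)$; if in $t_r$ and $t_r\to(c,d)$, then $t\to(t_l\vee c,d)$ (the left piece has leaves $0,\dots,i$ of $t$). For a multiset $i_1\le\dots\le i_q$ of leaves of $t$, the division $t\to(t_0,\dots,t_q)$ is obtained by splitting $t$ at $i_q$ into $(t',t_q)$ and dividing $t'$ at $i_1,\dots,i_{q-1}$ (for $q=0$ the division is $(t)$). For $s\in\mathcal{Y}_q$ with leaves numbered $0,\dots,q$, $(t_0,\dots,t_q)/s$ is obtained by grafting the root of $t_i$ onto leaf $i$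 of $s$. Product: $F_t\cdot F_s=\sum F_{(t_0,\dots,t_q)/s}$, summed over the $\binom{p+q}{q}$ multisets. Coproduct: $\Delta(F_t)=\sum_{i}F_{t_0}\otimes F_{t_1}$ over splittings. Monomial basis $M_t=\sum_{t\le s}\mu_{\mathcal{Y}_n}(t,s)F_s$ (Möbius function of the Tamari order). *)

theory Defs
  imports Complex_Main
begin

datatype tree = Leaf | Node tree tree

fun nodes :: "tree \<Rightarrow> nat" where
  "nodes Leaf = 0"
| "nodes (Node l r) = Suc (nodes l + nodes r)"

definition Y :: "nat \<Rightarrow> tree set" where
  "Y n = {t. nodes t = n}"

inductive rot :: "tree \<Rightarrow> tree \<Rightarrow> bool" where
  rot_root: "rot (Node (Node a b) c) (Node a (Node b c))"
| rot_left: "rot x y \<Longrightarrow> rot (Node x c) (Node y c)"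
| rot_right: "rot x y \<Longrightarrow> rot (Node c x) (Node c y)"

definition tamari_le :: "tree \<Rightarrow> tree \<Rightarrow> bool" where
  "tamari_le = rot\<^sup>*\<^sup>*"

section \<open>Permutations in one-line notation (lists with values 1..n)\<close>

definition st :: "nat list \<Rightarrow> nat list" where
  "st xs = map (\<lambda>x. card {y \<in> set xs. y \<le> x}) xs"

definition vee :: "nat list \<Rightarrow> nat list \<Rightarrow> nat list" where
  "vee \<sigma> \<tau> = map (\<lambda>x. x + length \<tau>) \<sigma> @ [length \<sigma> + length \<tau> + 1] @ \<tau>"

definition slash :: "nat list \<Rightarrow> nat list \<Rightarrow> nat list" where
  "slash \<sigma> \<tau> = \<sigma> @ map (\<lambda>x. x + length \<sigma>) \<tau>"

definition pcomp :: "nat list \<Rightarrow> nat list \<Rightarrow> nat list" where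
  "pcomp \<sigma> \<tau> = map (\<lambda>j. \<sigma> ! (j - 1)) \<tau>"

definition pinv :: "nat list \<Rightarrow> nat list" where
  "pinv \<zeta> = map (\<lambda>i. Suc (LEAST j. j < length \<zeta> \<and> \<zeta> ! j = i)) [1..<Suc (length \<zeta>)]"

definition is_perm :: "nat \<Rightarrow> nat list \<Rightarrow> bool" where
  "is_perm n \<sigma> \<longleftrightarrow> length \<sigma> = n \<and> distinct \<sigma> \<and> set \<sigma> = {1..n}"

definition Sh :: "nat \<Rightarrow> nat \<Rightarrow> nat list set" where
  "Sh p q = {\<zeta>. is_perm (p + q) \<zeta> \<and>
     (\<forall>i. 1 \<le> i \<and> i < p + q \<and> \<zeta> ! (i - 1) > \<zeta> ! i \<longrightarrow> i = p)}"

fun pos :: "nat \<Rightarrow> nat list \<Rightarrow> nat" where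
  "pos x [] = 0"
| "pos x (y # ys) = (if x = y then 0 else Suc (pos x ys))"

lemma pos_less: "x \<in> set xs \<Longrightarrow> pos x xs < length xs"
  by (induction xs) auto

lemma length_st[simp]: "length (st xs) = length xs"
  by (simp add: st_def)

function lam :: "nat list \<Rightarrow> tree" where
  "lam xs = (if xs = [] then Leaf else
     Node (lam (st (take (pos (Max (set xs)) xs) xs)))
          (lam (st (drop (Suc (pos (Max (set xs)) xs)) xs))))"
  by pat_completeness auto
termination
proof (relation "measure length", goal_cases)
  case 1 then show ?case by simp
next
  case (2 xs)
  then have "pos (Max (set xs)) xs < length xs" by (intro pos_less) simp
  then show ?case by simp
next
  case (3 xs) then show ?case by simp
qed

fun gamma :: "tree \<Rightarrow> nat list" where
  "gamma Leaf = []"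
| "gamma (Node l r) = vee (gamma l) (gamma r)"

definition f_zeta :: "nat list \<Rightarrow> tree \<Rightarrow> tree \<Rightarrow> tree" where
  "f_zeta \<zeta> s t = lam (pcomp (slash (gamma s) (gamma t)) (pinv \<zeta>))"

text \<open>splitting at leaf i (leaves numbered 0..nodes t, left to right)\<close>
fun split_at :: "tree \<Rightarrow> nat \<Rightarrow> tree \<times> tree" where
  "split_at Leaf i = (Leaf, Leaf)"
| "split_at (Node l r) i =
     (if i \<le> nodes l then (let (a, b) = split_at l i in (a, Node b r))
      else (let (c, d) = split_at r (i - nodes l - 1) in (Node l c, d)))"

text \<open>division at the multiset given by the reversed sorted list (largest first)\<close>
fun divide_rev :: "tree \<Rightarrow> nat list \<Rightarrow> tree list" where
  "divide_rev t [] = [t]"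
| "divide_rev t (i # is) = (let (t', tq) = split_at t i in divide_rev t' is @ [tq])"

definition divide :: "tree \<Rightarrow> nat list \<Rightarrow> tree list" where
  "divide t ms = divide_rev t (rev ms)"

fun graft :: "tree list \<Rightarrow> tree \<Rightarrow> tree" where
  "graft ts Leaf = hd ts"
| "graft ts (Node l r) = Node (graft (take (Suc (nodes l)) ts) l) (graft (drop (Suc (nodes l)) ts) r)"

type_synonym ysym = "tree \<Rightarrow> rat"

definition F :: "tree \<Rightarrow> ysym" where
  "F t = (\<lambda>u. if u = t then 1 else 0)"

text \<open>F_t \<cdot> F_s, summed over multisets i_1 \<le> ... \<le> i_q of leaves of t
  (encoded as sorted lists), counted with multiplicity\<close>
definition Fprod :: "tree \<Rightarrow> tree \<Rightarrow> ysym" where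
  "Fprod t s = (\<lambda>r. of_nat (card {ms. sorted ms \<and> length ms = nodes s \<and>
       (\<forall>i\<in>set ms. i \<le> nodes t) \<and> graft (divide t ms) s = r}))"

text \<open>bilinear extension (for finitely supported elements)\<close>
definition yprod :: "ysym \<Rightarrow> ysym \<Rightarrow> ysym" where
  "yprod a b = (\<lambda>r. \<Sum>t\<in>{t. a t \<noteq> 0}. \<Sum>u\<in>{u. b u \<noteq> 0}. a t * b u * Fprod t u r)"

text \<open>Moebius function of the Tamari order, via the recursion
  mu(x,x)=1, mu(x,y) = - sum_{x<=z<y} mu(x,z); the first argument of mob is
  a recursion bound (any bound >= size of the interval gives the same value)\<close>
fun mob :: "nat \<Rightarrow> tree \<Rightarrow> tree \<Rightarrow> int" where
  "mob 0 x y = 0"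
| "mob (Suc k) x y =
     (if x = y then 1
      else if tamari_le x y then
        - (\<Sum>z\<in>{z. tamari_le x z \<and> tamari_le z y \<and> z \<noteq> y}. mob k x z)
      else 0)"

definition mobius :: "tree \<Rightarrow> tree \<Rightarrow> int" where
  "mobius x y = mob (card {z. tamari_le x z \<and> tamari_le z y}) x y"

definition M :: "tree \<Rightarrow> ysym" where
  "M t = (\<lambda>u. \<Sum>s\<in>{s. tamari_le t s}. of_int (mobius t s) * F s u)"

definition is_max_pair :: "(tree \<times> tree) set \<Rightarrow> tree \<times> tree \<Rightarrow> bool" where
  "is_max_pair A m \<longleftrightarrow> m \<in> A \<and>
     (\<forall>x\<in>A. tamari_le (fst x) (fst m) \<and> tamari_le (snd x) (snd m))"

end

theory Submission
  imports Defs
begin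

text \<open>
  Encode a tree by the list of the left subtree sizes of its nodes, read in order. The Tamari order
  is the reversed componentwise order of these lists, and a componentwise minimum of such lists is
  again one. For the tree of a word, the entry at position \<open>j\<close> is the length of the longest run of
  smaller letters that ends just before \<open>j\<close>. In a shuffle of two words, the second with larger
  letters, each run is governed by one of the two words. So \<open>f_\<zeta>(s,t) \<le> r\<close> is a conjunction of
  lower bounds on the entries of \<open>s\<close> and of \<open>t\<close>, and the set of its solutions, if not empty, is a
  product of two principal ideals.

  The map that sends \<open>g\<close> to the function \<open>w \<mapsto> \<Sum>u\<le>w. g(u)\<close> is injective and takes \<open>M_r\<close> to the
  indicator of \<open>r\<close>. Since \<open>F_s F_t\<close> is the sum of \<open>F\<close> over all \<open>f_\<zeta>(s,t)\<close>, the image of \<open>M_s M_t\<close> at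
  \<open>w\<close> is a sum over \<open>\<zeta>\<close> of \<open>\<mu>(s,s') \<mu>(t,t')\<close> over a product of principal ideals, which is \<open>1\<close> or \<open>0\<close>
  according to whether \<open>(s,t)\<close> is its maximum.
\<close>

section \<open>Left subtree sizes\<close>

text \<open>A mirror form of the bracket vectors of Huang and Tamari. In this order, position
  \<open>j\<close> is the node between leaves \<open>j\<close> and \<open>j + 1\<close>.\<close>

fun lsizes :: "tree \<Rightarrow> nat list" where
  "lsizes Leaf = []"
| "lsizes (Node l r) = lsizes l @ nodes l # lsizes r"

lemma length_lsizes [simp]: "length (lsizes t) = nodes t"
  by (induction t) auto

lemma lsizes_Node_nth:
  "lsizes (Node l r) ! j =
     (if j < nodes l then lsizes l ! j else if j = nodes l then nodes l
      else lsizes r ! (j - nodes l - 1))"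
  by (auto simp: nth_append nth_Cons')

lemma lsizes_le: "j < nodes t \<Longrightarrow> lsizes t ! j \<le> j"
proof (induction t arbitrary: j)
  case (Node l r)
  then show ?case
    using Node.IH(2)[of "j - nodes l - 1"] by (fastforce simp: lsizes_Node_nth simp del: lsizes.simps)
qed auto

text \<open>The left subtree of node \<open>j\<close> occupies the positions from
  \<open>j - lsizes t ! j\<close> to \<open>j - 1\<close>. The premises place node \<open>i\<close>
  there, so the whole left subtree of \<open>i\<close> lies there too.\<close>

lemma lsizes_nested:
  "\<lbrakk>j < nodes t; i < j; j \<le> i + lsizes t ! j\<rbrakk> \<Longrightarrow> j + lsizes t ! i \<le> i + lsizes t ! j"
proof (induction t arbitrary: i j)
  case (Node l r)
  consider "j < nodes l" | "j = nodes l" | "j > nodes l" by linarith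
  then show ?case
  proof cases
    case 1
    then show ?thesis
      using Node by (auto simp: lsizes_Node_nth simp del: lsizes.simps)
  next
    case 2
    then show ?thesis
      using Node.prems lsizes_le[of i l] by (auto simp: lsizes_Node_nth simp del: lsizes.simps)
  next
    case 3
    define j' where "j' = j - nodes l - 1"
    have j: "j = nodes l + 1 + j'" "j' < nodes r"
      using 3 Node.prems(1) by (auto simp: j'_def)
    have eq: "lsizes (Node l r) ! j = lsizes r ! j'"
      using 3 by (auto simp: lsizes_Node_nth j'_def simp del: lsizes.simps)
    have "lsizes r ! j' \<le> j'" using j lsizes_le by blast
    then have i: "i > nodes l" using eq j Node.prems by linarith
    define i' where "i' = i - nodes l - 1"
    have i': "i = nodes l + 1 + i'" using i by (auto simp: i'_def)
    have eqi: "lsizes (Node l r) ! i = lsizes r ! i'"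
      using i by (auto simp: lsizes_Node_nth i'_def simp del: lsizes.simps)
    have "j' + lsizes r ! i' \<le> i' + lsizes r ! j'"
      using Node.IH(2)[of j' i'] Node.prems j i' eq by auto
    then show ?thesis using eq eqi j i' by simp
  qed
qed auto

text \<open>The bound and the nesting property characterise lists of left subtree sizes. The root
  has to be the last position \<open>k\<close> with \<open>v ! k = k\<close>, and the parts before
  and after it inherit both properties.\<close>

lemma lsizes_exists:
  assumes "\<And>j. j < length v \<Longrightarrow> v ! j \<le> j"
    and "\<And>i j. \<lbrakk>j < length v; i < j; j \<le> i + v ! j\<rbrakk> \<Longrightarrow> j + v ! i \<le> i + v ! j"
  shows "\<exists>t. lsizes t = v"
  using assms
proof (induction v rule: length_induct)
  case (1 v)
  note le = "1.prems"(1) and nested = "1.prems"(2)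
  show ?case
  proof (cases "v = []")
    case True
    then have "lsizes Leaf = v" by simp
    then show ?thesis by blast
  next
    case False
    define K where "K = {k. k < length v \<and> v ! k = k}"
    have fin: "finite K" and ne: "0 \<in> K"
      using False le[of 0] by (auto simp: K_def)
    define k where "k = Max K"
    have "k \<in> K" unfolding k_def using fin ne by (intro Max_in) auto
    then have k: "k < length v" "v ! k = k" by (auto simp: K_def)
    \<comment> \<open>A left subtree at \<open>j\<close> that reached back to \<open>k\<close> would
      by nesting reach back to position 0, against the maximality of \<open>k\<close>.\<close>
    have last: "v ! j < j - k" if j: "j < length v" "k < j" for j
    proof (rule ccontr)
      assume "\<not> v ! j < j - k"
      then have "j \<le> k + v ! j" by linarith
      from nested[OF j this] have "v ! j = j" using k le[OF j(1)] by simp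
      then have "j \<in> K" using j by (simp add: K_def)
      then have "j \<le> k" unfolding k_def using fin by (simp add: Max_ge)
      then show False using j by simp
    qed
    have "\<exists>l. lsizes l = take k v"
      using "1.IH"[rule_format, of "take k v"] k le nested by auto
    then obtain l where l: "lsizes l = take k v" by blast
    have "\<exists>r. lsizes r = drop (Suc k) v"
    proof (rule "1.IH"[rule_format])
      show "length (drop (Suc k) v) < length v" using k by simp
      show "drop (Suc k) v ! j \<le> j" if "j < length (drop (Suc k) v)" for j
        using last[of "Suc k + j"] that by (simp add: less_diff_conv)
      show "j + drop (Suc k) v ! i \<le> i + drop (Suc k) v ! j"
        if "j < length (drop (Suc k) v)" "i < j" "j \<le> i + drop (Suc k) v ! j" for i j
        using nested[of "Suc k + j" "Suc k + i"] that by simp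
    qed
    then obtain r where r: "lsizes r = drop (Suc k) v" by blast
    have "nodes l = k" using l k by (metis length_lsizes length_take min.absorb4)
    then have "lsizes (Node l r) = v" using l r k id_take_nth_drop[OF k(1)] by simp
    then show ?thesis by blast
  qed
qed

text \<open>The root is the last position whose entry equals its index, because entries from a right
  subtree are too small for that. So the list determines where to cut it.\<close>

lemma lsizes_inj: "lsizes s = lsizes t \<Longrightarrow> s = t"
proof (induction s arbitrary: t)
  case Leaf
  then show ?case by (cases t) auto
next
  case (Node l r)
  then obtain l' r' where t: "t = Node l' r'" by (cases t) auto
  have *: False if "lsizes (Node a b) = lsizes (Node a' b')" "nodes a < nodes a'" for a b a' b'
  proof -
    have "nodes (Node a b) = nodes (Node a' b')" using that(1) by (metis length_lsizes)
    moreover have "lsizes (Node a b) ! nodes a' = nodes a'"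
      using that(1) by (simp add: lsizes_Node_nth del: lsizes.simps)
    ultimately have "nodes a' - nodes a - 1 < nodes b"
      "lsizes b ! (nodes a' - nodes a - 1) = nodes a'"
      using that(2) by (auto simp: lsizes_Node_nth simp del: lsizes.simps)
    then show False using lsizes_le[of "nodes a' - nodes a - 1" b] that(2) by simp
  qed
  have "nodes l = nodes l'"
    using *[of l r l' r'] *[of l' r' l r] Node.prems t by (metis linorder_neqE_nat)
  then show ?case using Node t by simp
qed

section \<open>The Tamari order\<close>

lemma tamari_le_refl [simp]: "tamari_le t t"
  by (simp add: tamari_le_def)

lemma tamari_le_trans: "tamari_le r s \<Longrightarrow> tamari_le s t \<Longrightarrow> tamari_le r t"
  by (auto simp: tamari_le_def)

lemma tamari_le_NodeL: "tamari_le x y \<Longrightarrow> tamari_le (Node x c) (Node y c)"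
  unfolding tamari_le_def
  by (induction rule: rtranclp_induct) (auto intro: rtranclp.intros rot.intros)

lemma tamari_le_NodeR: "tamari_le x y \<Longrightarrow> tamari_le (Node c x) (Node c y)"
  unfolding tamari_le_def
  by (induction rule: rtranclp_induct) (auto intro: rtranclp.intros rot.intros)

lemma rot_nodes: "rot s t \<Longrightarrow> nodes s = nodes t"
  by (induction rule: rot.induct) auto

text \<open>A rotation changes one entry only: that of the upper node drops from
  \<open>nodes a + nodes b + 1\<close> to \<open>nodes b\<close>.\<close>

lemma rot_lsizes: "rot s t \<Longrightarrow> list_all2 (\<le>) (lsizes t) (lsizes s)"
  by (induction rule: rot.induct)
    (auto simp: rot_nodes intro!: list_all2_appendI list_all2_refl list.rel_intros)

lemma tamari_le_lsizes: "tamari_le s t \<Longrightarrow> list_all2 (\<le>) (lsizes t) (lsizes s)"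
  unfolding tamari_le_def
proof (induction rule: rtranclp_induct)
  case (step y z)
  then show ?case using rot_lsizes list_all2_trans[of "(\<le>)" "(\<le>)" "(\<le>)"] by (meson order_trans)
qed (auto intro: list_all2_refl)

text \<open>An entry equal to its index marks a node on the leftmost path from the root, and
  rotations along this path lift the node to the root. Its former ancestors lose the node and its
  left subtree from their own left subtrees, whence the \<open>min\<close>.\<close>

lemma tamari_le_rotate_to_root:
  assumes "k < nodes s" "lsizes s ! k = k"
  shows "\<exists>a b. tamari_le s (Node a b) \<and> nodes a = k \<and> nodes s = Suc (k + nodes b) \<and>
     lsizes a = take k (lsizes s) \<and> (\<forall>j < nodes b. lsizes b ! j = min (lsizes s ! (Suc k + j)) j)"
  using assms
proof (induction s)
  case (Node l r)
  consider "nodes l < k" | "nodes l = k" | "nodes l > k" by linarith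
  then show ?case
  proof cases
    case 1
    then have "k - nodes l - 1 < nodes r" "lsizes r ! (k - nodes l - 1) = k"
      using Node.prems by (auto simp: lsizes_Node_nth simp del: lsizes.simps)
    then show ?thesis
      using 1 lsizes_le[of "k - nodes l - 1" r] by linarith
  next
    case 2
    then show ?thesis using lsizes_le[of _ r]
      by (intro exI[of _ l] exI[of _ r]) (auto simp: nth_append)
  next
    case 3
    then have "lsizes l ! k = k"
      using Node.prems by (auto simp: lsizes_Node_nth simp del: lsizes.simps)
    with Node.IH(1) 3 obtain a b where ab: "tamari_le l (Node a b)" "nodes a = k"
      "nodes l = Suc (k + nodes b)" "lsizes a = take k (lsizes l)"
      "\<And>j. j < nodes b \<Longrightarrow> lsizes b ! j = min (lsizes l ! (Suc k + j)) j" by blast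
    have "tamari_le (Node l r) (Node (Node a b) r)" using ab by (intro tamari_le_NodeL)
    moreover have "tamari_le (Node (Node a b) r) (Node a (Node b r))"
      unfolding tamari_le_def by (intro r_into_rtranclp rot_root)
    ultimately have "tamari_le (Node l r) (Node a (Node b r))" by (rule tamari_le_trans)
    moreover have "lsizes (Node b r) ! j = min (lsizes (Node l r) ! (Suc k + j)) j"
      if "j < nodes (Node b r)" for j
    proof (cases "j \<le> nodes b")
      case True
      then show ?thesis
        using ab(3,5) by (auto simp: lsizes_Node_nth simp del: lsizes.simps)
    next
      case False
      then have "lsizes r ! (j - nodes b - 1) \<le> j"
        using that lsizes_le[of "j - nodes b - 1" r] by (simp add: less_diff_conv2)
      then show ?thesis
        using False ab(3) by (auto simp: lsizes_Node_nth simp del: lsizes.simps)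
    qed
    ultimately show ?thesis using ab(2-4)
      by (intro exI[of _ a] exI[of _ "Node b r"]) auto
  qed
qed auto

text \<open>For the converse, the root position of \<open>t\<close> has an entry in \<open>s\<close>
  that equals its index, being bounded from both sides. Rotating that node of \<open>s\<close> to
  the root reduces the claim to the two subtrees. The truncation by \<open>min\<close> is harmless,
  as the entries of \<open>r\<close> are at most their indices.\<close>

lemma tamari_le_iff_lsizes: "tamari_le s t \<longleftrightarrow> list_all2 (\<le>) (lsizes t) (lsizes s)"
proof
  assume "list_all2 (\<le>) (lsizes t) (lsizes s)"
  then show "tamari_le s t"
  proof (induction t arbitrary: s)
    case Leaf
    then show ?case by (cases s) auto
  next
    case (Node l r)
    have len: "nodes s = Suc (nodes l + nodes r)"
      using list_all2_lengthD[OF Node.prems] by simp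
    have le: "lsizes (Node l r) ! j \<le> lsizes s ! j" if "j < nodes s" for j
      using Node.prems len that by (auto simp: list_all2_conv_all_nth simp del: lsizes.simps)
    define k where "k = nodes l"
    have "lsizes s ! k = k"
      using le[of k] lsizes_le[of k s] len
      by (auto simp: k_def lsizes_Node_nth simp del: lsizes.simps)
    then obtain a b where ab: "tamari_le s (Node a b)" "nodes a = k"
      "nodes s = Suc (k + nodes b)" "lsizes a = take k (lsizes s)"
      "\<And>j. j < nodes b \<Longrightarrow> lsizes b ! j = min (lsizes s ! (Suc k + j)) j"
      using tamari_le_rotate_to_root[of k s] len by (auto simp: k_def)
    have "list_all2 (\<le>) (lsizes l) (lsizes a)"
      unfolding list_all2_conv_all_nth
    proof (intro conjI allI impI)
      show "length (lsizes l) = length (lsizes a)" using ab by (simp add: k_def)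
      show "lsizes l ! j \<le> lsizes a ! j" if "j < length (lsizes l)" for j
        using le[of j] that ab(4) len by (auto simp: k_def nth_append)
    qed
    moreover have "list_all2 (\<le>) (lsizes r) (lsizes b)"
      unfolding list_all2_conv_all_nth
    proof (intro conjI allI impI)
      show "length (lsizes r) = length (lsizes b)" using ab len by (simp add: k_def)
      show "lsizes r ! j \<le> lsizes b ! j" if "j < length (lsizes r)" for j
        using le[of "Suc k + j"] that ab(3,5) len lsizes_le[of j r]
        by (auto simp: k_def nth_append)
    qed
    ultimately have "tamari_le a l" "tamari_le b r" using Node.IH by auto
    then show ?case using ab(1) tamari_le_NodeL tamari_le_NodeR tamari_le_trans by meson
  qed
qed (rule tamari_le_lsizes)

lemma tamari_le_nodes: "tamari_le s t \<Longrightarrow> nodes s = nodes t"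
  by (metis tamari_le_lsizes list_all2_lengthD length_lsizes)

lemma tamari_le_antisym: "tamari_le s t \<Longrightarrow> tamari_le t s \<Longrightarrow> s = t"
  by (auto simp: tamari_le_iff_lsizes list_all2_conv_all_nth
      intro!: lsizes_inj nth_equalityI order_antisym)

lemma finite_nodes_le: "finite {t. nodes t \<le> n}"
proof (induction n)
  case 0
  have "{t. nodes t \<le> 0} = {Leaf}" by (auto elim: nodes.elims)
  then show ?case by simp
next
  case (Suc n)
  have "{t. nodes t \<le> Suc n} \<subseteq> insert Leaf ((\<lambda>(l, r). Node l r) ` ({t. nodes t \<le> n} \<times> {t. nodes t \<le> n}))"
  proof
    fix t assume "t \<in> {t. nodes t \<le> Suc n}"
    then show "t \<in> insert Leaf ((\<lambda>(l, r). Node l r) ` ({t. nodes t \<le> n} \<times> {t. nodes t \<le> n}))"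
      by (cases t) auto
  qed
  then show ?case using Suc by (meson finite_SigmaI finite_imageI finite_insert finite_subset)
qed

lemma finite_Y [simp]: "finite (Y n)"
  by (rule finite_subset[OF _ finite_nodes_le[of n]]) (auto simp: Y_def)

lemma finite_tamari_up [simp]: "finite {t. tamari_le s t}"
  by (rule finite_subset[OF _ finite_Y[of "nodes s"]]) (auto simp: Y_def tamari_le_nodes)

lemma finite_tamari_down [simp]: "finite {t. tamari_le t s}"
  by (rule finite_subset[OF _ finite_Y[of "nodes s"]]) (auto simp: Y_def tamari_le_nodes)

text \<open>Inequalities with a threshold \<open>k\<close> are the form in which
  \<open>lsizes_lam\<close> reads entries off a word. The threshold \<open>j - lsizes t ! j\<close>
  recovers the comparison of entries.\<close>

lemma tamari_le_iff:
  "tamari_le s t \<longleftrightarrow> nodes s = nodes t \<and>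
     (\<forall>j < nodes t. \<forall>k \<le> j. j \<le> k + lsizes t ! j \<longrightarrow> j \<le> k + lsizes s ! j)"
proof -
  have "lsizes t ! j \<le> lsizes s ! j"
    if "j < nodes t" "\<forall>k \<le> j. j \<le> k + lsizes t ! j \<longrightarrow> j \<le> k + lsizes s ! j" for j
    using that(2)[rule_format, of "j - lsizes t ! j"] lsizes_le[OF that(1)] by simp
  then show ?thesis
    unfolding tamari_le_iff_lsizes list_all2_conv_all_nth
    by (auto intro: order_trans)
qed

text \<open>Lower bounds on entries survive componentwise minima, and the minimum over
  \<open>S\<close> is the list of a tree \<open>m\<close>, the maximum of \<open>S\<close>. Passing
  to a smaller tree raises entries, so \<open>S\<close> is closed downwards.\<close>

lemma tamari_principal_ideal:
  fixes R :: "nat \<Rightarrow> nat \<Rightarrow> bool" and n :: nat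
  defines "S \<equiv> {s \<in> Y n. \<forall>k j. j < n \<and> R k j \<longrightarrow> j \<le> k + lsizes s ! j}"
  assumes "S \<noteq> {}"
  shows "\<exists>m \<in> Y n. S = {s. tamari_le s m}"
proof -
  define v where "v = map (\<lambda>j. Min ((\<lambda>s. lsizes s ! j) ` S)) [0..<n]"
  have fin: "finite S" unfolding S_def by simp
  have len: "length v = n" by (simp add: v_def)
  have v_le: "v ! j \<le> lsizes s ! j" if "s \<in> S" "j < n" for s j
    using that fin by (auto simp: v_def)
  have v_ex: "\<exists>s \<in> S. v ! j = lsizes s ! j" if "j < n" for j
  proof -
    have "Min ((\<lambda>s. lsizes s ! j) ` S) \<in> (\<lambda>s. lsizes s ! j) ` S"
      using fin assms(2) by (intro Min_in) auto
    then show ?thesis using that by (auto simp: v_def)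
  qed
  have nodes: "nodes s = n" if "s \<in> S" for s using that by (simp add: S_def Y_def)
  have "\<exists>m. lsizes m = v"
  proof (rule lsizes_exists)
    show "v ! j \<le> j" if "j < length v" for j
      using that len v_ex[of j] nodes lsizes_le by fastforce
    show "j + v ! i \<le> i + v ! j" if ij: "j < length v" "i < j" "j \<le> i + v ! j" for i j
    proof -
      \<comment> \<open>The minimum at \<open>j\<close> is attained by some \<open>s\<close>. Its
        nesting property passes to \<open>v\<close>, since the entry of \<open>v\<close> at
        \<open>i\<close> is at most that of \<open>s\<close>.\<close>
      obtain s where s: "s \<in> S" "v ! j = lsizes s ! j" using v_ex[of j] ij(1) len by auto
      then have "j + lsizes s ! i \<le> i + v ! j" using lsizes_nested[of j s i] ij nodes len by auto
      then show ?thesis using v_le[of s i] s ij len by auto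
    qed
  qed
  then obtain m where m: "lsizes m = v" by blast
  have "nodes m = n" using m len by (metis length_lsizes)
  have "m \<in> S"
    using \<open>nodes m = n\<close> v_ex m by (force simp: S_def Y_def)
  moreover have "tamari_le s m" if "s \<in> S" for s
    using v_le[OF that] nodes[OF that] m len by (simp add: tamari_le_iff_lsizes list_all2_conv_all_nth)
  moreover have "s \<in> S" if "tamari_le s m" for s
  proof -
    have "lsizes m ! j \<le> lsizes s ! j" if "j < n" for j
      using \<open>tamari_le s m\<close> that \<open>nodes m = n\<close>
      by (simp add: tamari_le_iff_lsizes list_all2_conv_all_nth)
    moreover have "s \<in> Y n" using that \<open>nodes m = n\<close> tamari_le_nodes by (auto simp: Y_def)
    ultimately show ?thesis
      using \<open>m \<in> S\<close> unfolding S_def by (fastforce intro: order_trans[OF _ add_left_mono])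
  qed
  ultimately show ?thesis using \<open>nodes m = n\<close> by (auto simp: Y_def)
qed

section \<open>Trees of words\<close>

declare lam.simps [simp del]

lemma lam_Nil [simp]: "lam [] = Leaf"
  by (simp add: lam.simps)

lemma pos_map: "inj_on f (insert x (set xs)) \<Longrightarrow> pos (f x) (map f xs) = pos x xs"
proof (induction xs)
  case (Cons y ys)
  have "inj_on f (insert x (set ys))" by (rule inj_on_subset[OF Cons.prems]) auto
  moreover have "f x = f y \<longleftrightarrow> x = y" using Cons.prems by (auto simp: inj_on_def)
  ultimately show ?case using Cons.IH by simp
qed auto

lemma st_map:
  assumes "strict_mono_on (set xs) f"
  shows "st (map f xs) = st xs"
proof -
  have "card {y \<in> f ` set xs. y \<le> f x} = card {y \<in> set xs. y \<le> x}" if "x \<in> set xs" for x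
  proof -
    have "{y \<in> f ` set xs. y \<le> f x} = f ` {y \<in> set xs. y \<le> x}"
      using assms that by (auto simp: strict_mono_on_less_eq)
    moreover have "inj_on f {y \<in> set xs. y \<le> x}"
      using strict_mono_on_imp_inj_on[OF assms] by (rule inj_on_subset) auto
    ultimately show ?thesis by (simp add: card_image)
  qed
  then show ?thesis by (simp add: st_def)
qed

lemma lam_map:
  assumes "strict_mono_on (set xs) f"
  shows "lam (map f xs) = lam xs"
proof (cases "xs = []")
  case False
  have inj: "inj_on f (set xs)" using assms by (rule strict_mono_on_imp_inj_on)
  have Max: "Max (set xs) \<in> set xs" using False by simp
  have "Max (set (map f xs)) = f (Max (set xs))"
    using Max assms by (intro Max_eqI) (auto simp: strict_mono_on_less_eq)
  then have pos: "pos (Max (set (map f xs))) (map f xs) = pos (Max (set xs)) xs"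
    using pos_map[of f "Max (set xs)" xs] inj Max by (simp add: insert_absorb)
  have "st (map f (take k xs)) = st (take k xs)" "st (map f (drop k xs)) = st (drop k xs)" for k
    using assms by (auto intro!: st_map elim!: monotone_on_subset dest: in_set_takeD in_set_dropD)
  with pos False show ?thesis
    by (simp add: lam.simps[of xs] lam.simps[of "map f xs"] take_map drop_map)
qed simp

lemma lam_st: "lam (st xs) = lam xs"
proof -
  have "strict_mono_on (set xs) (\<lambda>x. card {y \<in> set xs. y \<le> x})"
  proof (rule strict_mono_onI)
    fix r s assume "r \<in> set xs" "s \<in> set xs" "r < s"
    then have "{y \<in> set xs. y \<le> r} \<subseteq> {y \<in> set xs. y \<le> s}"
      "s \<in> {y \<in> set xs. y \<le> s}" "s \<notin> {y \<in> set xs. y \<le> r}"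
      by auto
    then have "{y \<in> set xs. y \<le> r} \<subset> {y \<in> set xs. y \<le> s}" by blast
    then show "card {y \<in> set xs. y \<le> r} < card {y \<in> set xs. y \<le> s}"
      by (intro psubset_card_mono) auto
  qed
  then show ?thesis unfolding st_def by (rule lam_map)
qed

lemma pos_append: "x \<notin> set a \<Longrightarrow> pos x (a @ x # b) = length a"
  by (induction a) auto

text \<open>The recursion of \<open>lam\<close> freed from standardisation, so that
  \<open>lam\<close> can be used on words with arbitrary distinct letters.\<close>

lemma lam_append:
  assumes "\<And>x. x \<in> set a \<union> set b \<Longrightarrow> x < m"
  shows "lam (a @ m # b) = Node (lam a) (lam b)"
proof -
  have "Max (set (a @ m # b)) = m"
    using assms by (intro Max_eqI) (auto intro: less_imp_le)
  moreover have "pos m (a @ m # b) = length a"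
    using assms by (intro pos_append) auto
  ultimately show ?thesis by (simp add: lam.simps[of "a @ m # b"] lam_st)
qed

text \<open>Matches the recursion in \<open>lam_append\<close>, so that claims about
  \<open>lam\<close> can be proved on words.\<close>

lemma distinct_max_induct [consumes 1, case_names Nil split]:
  fixes xs :: "'a :: linorder list"
  assumes "distinct xs"
    and "P []"
    and "\<And>a m b. \<lbrakk>distinct (a @ m # b); \<And>x. x \<in> set a \<union> set b \<Longrightarrow> x < m; P a; P b\<rbrakk>
          \<Longrightarrow> P (a @ m # b)"
  shows "P xs"
  using assms(1)
proof (induction xs rule: length_induct)
  case (1 xs)
  show ?case
  proof (cases "xs = []")
    case False
    define m where "m = Max (set xs)"
    have "m \<in> set xs" using False by (simp add: m_def)
    then obtain a b where xs: "xs = a @ m # b" by (meson split_list)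
    have "x < m" if "x \<in> set a \<union> set b" for x
    proof -
      have "x \<le> m" unfolding m_def using that xs by (intro Max_ge) auto
      moreover have "x \<noteq> m" using that 1(2) xs by auto
      ultimately show ?thesis by simp
    qed
    moreover have "P a" "P b" using 1 xs by auto
    ultimately show ?thesis using assms(3) 1(2) xs by blast
  qed (simp add: assms(2))
qed

lemma nodes_lam: "distinct xs \<Longrightarrow> nodes (lam xs) = length xs"
proof (induction xs rule: distinct_max_induct)
  case (split a m b)
  then show ?case by (subst lam_append) auto
qed simp

text \<open>A run of smaller letters that ends inside \<open>b\<close> cannot pass the largest
  letter \<open>m\<close>, just as a left subtree inside the right subtree of the root does not
  contain the root.\<close>

lemma lsizes_lam:
  assumes "distinct xs" "k \<le> j" "j < length xs"
  shows "j \<le> k + lsizes (lam xs) ! j \<longleftrightarrow> (\<forall>i \<in> {k..<j}. xs ! i < xs ! j)"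
  using assms
proof (induction xs arbitrary: k j rule: distinct_max_induct)
  case (split a m b)
  have lam: "lam (a @ m # b) = Node (lam a) (lam b)" using split.hyps(2) by (rule lam_append)
  have len: "nodes (lam a) = length a" "nodes (lam b) = length b"
    using split.hyps(1) by (auto simp: nodes_lam)
  consider "j < length a" | "j = length a" | "j > length a" by linarith
  then show ?case
  proof cases
    case 1
    then show ?thesis
      using split.IH(1)[of k j] split.prems len by (auto simp: lam nth_append)
  next
    case 2
    then show ?thesis using split.hyps(2) len by (auto simp: lam nth_append)
  next
    case 3
    define j' where "j' = j - length a - 1"
    have j: "j = Suc (length a + j')" "j' < length b" using 3 split.prems by (auto simp: j'_def)
    have eq: "lsizes (lam (a @ m # b)) ! j = lsizes (lam b) ! j'"
      using j len by (simp add: lam nth_append)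
    have xj: "(a @ m # b) ! j = b ! j'" using j by (simp add: nth_append)
    have "lsizes (lam b) ! j' \<le> j'" using j len lsizes_le[of j' "lam b"] by simp
    show ?thesis
    proof (cases "k \<le> length a")
      case True
      have "b ! j' < m" using split.hyps(2) j by auto
      then have "\<not> (a @ m # b) ! length a < (a @ m # b) ! j" using xj by simp
      moreover have "length a \<in> {k..<j}" using True 3 by simp
      ultimately show ?thesis
        using eq j True \<open>lsizes (lam b) ! j' \<le> j'\<close> by fastforce
    next
      case False
      define k' where "k' = k - length a - 1"
      have k: "k = Suc (length a + k')" using False by (simp add: k'_def)
      have "{k..<j} = (\<lambda>i. Suc (length a + i)) ` {k'..<j'}"
        unfolding k j using image_add_atLeastLessThan[of "Suc (length a)" k' j']
        by (simp add: add.commute)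
      then show ?thesis
        using split.IH(2)[of k' j'] split.prems eq j k xj by (auto simp: nth_append)
    qed
  qed
qed auto

section \<open>The section \<open>gamma\<close> of \<open>lam\<close>, and splitting as cutting of
  words\<close>

lemma length_gamma [simp]: "length (gamma t) = nodes t"
  by (induction t) (auto simp: vee_def)

lemma set_gamma: "set (gamma t) = {1..nodes t}"
proof (induction t)
  case (Node l r)
  have "(\<lambda>x. x + nodes r) ` {1..nodes l} = {1 + nodes r..nodes l + nodes r}"
    using image_add_atLeastAtMost[of "nodes r" 1 "nodes l"] by (simp add: add.commute)
  then show ?case using Node by (auto simp: vee_def)
qed simp

lemma distinct_gamma [simp]: "distinct (gamma t)"
  by (rule card_distinct) (simp add: set_gamma)

lemma lam_gamma [simp]: "lam (gamma t) = t"
proof (induction t)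
  case (Node l r)
  have "lam (gamma (Node l r)) = Node (lam (map (\<lambda>x. x + nodes r) (gamma l))) (lam (gamma r))"
    unfolding gamma.simps vee_def append_Cons append_Nil length_gamma
    by (rule lam_append) (auto simp: set_gamma)
  also have "lam (map (\<lambda>x. x + nodes r) (gamma l)) = lam (gamma l)"
    by (rule lam_map) (auto intro: strict_mono_onI)
  finally show ?case using Node by simp
qed simp

text \<open>The leaves of \<open>lam xs\<close> are the gaps of the word \<open>xs\<close>, ends
  included.\<close>

lemma split_at_lam:
  assumes "distinct xs" "i \<le> length xs"
  shows "split_at (lam xs) i = (lam (take i xs), lam (drop i xs))"
  using assms
proof (induction xs arbitrary: i rule: distinct_max_induct)
  case (split a m b)
  have lam: "lam (a @ m # b) = Node (lam a) (lam b)" using split.hyps(2) by (rule lam_append)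
  have len: "nodes (lam a) = length a" using split.hyps(1) by (simp add: nodes_lam)
  show ?case
  proof (cases "i \<le> length a")
    case True
    have "lam (drop i a @ m # b) = Node (lam (drop i a)) (lam b)"
      using split.hyps(2) by (intro lam_append) (auto dest: in_set_dropD)
    then show ?thesis using True split.IH(1) len by (simp add: lam)
  next
    case False
    define i' where "i' = i - length a - 1"
    have i: "i = Suc (length a + i')" using False by (simp add: i'_def)
    have "lam (a @ m # take i' b) = Node (lam a) (lam (take i' b))"
      using split.hyps(2) by (intro lam_append) (auto dest: in_set_takeD)
    then show ?thesis using i split.IH(2)[of i'] split.prems len by (simp add: lam)
  qed
qed auto

section \<open>Shuffles of words\<close>

text \<open>The cutting positions are listed in decreasing order.\<close>

fun pieces :: "'a list \<Rightarrow> nat list \<Rightarrow> 'a list list" where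
  "pieces xs [] = [xs]"
| "pieces xs (i # is) = pieces (take i xs) is @ [drop i xs]"

fun interleave :: "'a list list \<Rightarrow> 'a list \<Rightarrow> 'a list" where
  "interleave Ps [] = hd Ps"
| "interleave Ps (y # ys) = hd Ps @ y # interleave (tl Ps) ys"

text \<open>If \<open>ms\<close> is sorted, as long as \<open>ys\<close>, and bounded by
  \<open>length xs\<close>, then \<open>ms ! k\<close> is the number of letters of \<open>xs\<close>
  before \<open>ys ! k\<close>, which thus stands at position \<open>ms ! k + k\<close>.\<close>

definition shuffle :: "'a list \<Rightarrow> 'a list \<Rightarrow> nat list \<Rightarrow> 'a list" where
  "shuffle xs ys ms = interleave (pieces xs (rev ms)) ys"

lemma length_pieces [simp]: "length (pieces xs is) = Suc (length is)"
  by (induction xs "is" rule: pieces.induct) auto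

lemma set_pieces: "P \<in> set (pieces xs is) \<Longrightarrow> set P \<subseteq> set xs"
  by (induction xs "is" rule: pieces.induct) (auto dest: in_set_takeD in_set_dropD)

lemma set_interleave:
  "length Ps = Suc (length ys) \<Longrightarrow> set (interleave Ps ys) = (\<Union>P \<in> set Ps. set P) \<union> set ys"
proof (induction Ps ys rule: interleave.induct)
  case (1 Ps)
  then show ?case by (cases Ps) auto
next
  case (2 Ps y ys)
  then show ?case by (cases Ps) auto
qed

lemma interleave_append:
  "length Ps = Suc (length a + Suc (length b)) \<Longrightarrow> interleave Ps (a @ m # b) =
     interleave (take (Suc (length a)) Ps) a @ m # interleave (drop (Suc (length a)) Ps) b"
proof (induction a arbitrary: Ps)
  case Nil
  then show ?case by (cases Ps) auto
next
  case (Cons x a)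
  then show ?case by (cases Ps) auto
qed

text \<open>Cuts are made from the largest down, so the recursion removes the last letter of
  \<open>ys\<close> and the last piece of \<open>xs\<close>. The inductions on shuffles follow
  it.\<close>

lemma shuffle_snoc:
  "length ms = length ys \<Longrightarrow>
   shuffle xs (ys @ [y]) (ms @ [i]) = shuffle (take i xs) ys ms @ y # drop i xs"
  by (simp add: shuffle_def interleave_append)

lemma divide_rev_lam:
  "\<lbrakk>distinct xs; sorted_wrt (\<ge>) is; \<forall>i \<in> set is. i \<le> length xs\<rbrakk> \<Longrightarrow>
   divide_rev (lam xs) is = map lam (pieces xs is)"
  by (induction xs "is" rule: pieces.induct) (auto simp: split_at_lam)

text \<open>The letters of \<open>ys\<close> exceed those of the pieces, so the largest letter of
  \<open>ys\<close> is the root, and so on downwards: \<open>lam ys\<close> forms the top of the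
  tree, and each piece fills the gap that is a leaf of it.\<close>

lemma lam_interleave:
  assumes "distinct ys" "length Ps = Suc (length ys)"
    and "\<And>P x y. \<lbrakk>P \<in> set Ps; x \<in> set P; y \<in> set ys\<rbrakk> \<Longrightarrow> x < y"
  shows "lam (interleave Ps ys) = graft (map lam Ps) (lam ys)"
  using assms
proof (induction ys arbitrary: Ps rule: distinct_max_induct)
  case Nil
  then show ?case by (cases Ps) auto
next
  case (split a m b)
  define Pa Pb where "Pa = take (Suc (length a)) Ps" and "Pb = drop (Suc (length a)) Ps"
  have Ps: "set Pa \<subseteq> set Ps" "set Pb \<subseteq> set Ps"
    by (auto simp: Pa_def Pb_def dest: in_set_takeD in_set_dropD)
  have len: "length Pa = Suc (length a)" "length Pb = Suc (length b)"
    using split.prems by (auto simp: Pa_def Pb_def)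
  have "interleave Ps (a @ m # b) = interleave Pa a @ m # interleave Pb b"
    using split.prems by (simp add: interleave_append Pa_def Pb_def)
  also have "lam \<dots> = Node (lam (interleave Pa a)) (lam (interleave Pb b))"
    using Ps split.hyps(2) split.prems(2) len by (intro lam_append) (auto simp: set_interleave)
  also have "lam (interleave Pa a) = graft (map lam Pa) (lam a)"
    using Ps split.prems len by (intro split.IH) auto
  also have "lam (interleave Pb b) = graft (map lam Pb) (lam b)"
    using Ps split.prems len by (intro split.IH) auto
  also have "Node (graft (map lam Pa) (lam a)) (graft (map lam Pb) (lam b)) =
      graft (map lam Ps) (lam (a @ m # b))"
    using split.hyps(1) lam_append[OF split.hyps(2)]
    by (simp add: nodes_lam Pa_def Pb_def take_map drop_map)
  finally show ?case .
qed

text \<open>Translates the division and grafting of \<open>Fprod\<close> into shuffles of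
  words.\<close>

lemma lam_shuffle:
  assumes "distinct xs" "distinct ys" "length ms = length ys"
    and "sorted ms" "\<And>i. i \<in> set ms \<Longrightarrow> i \<le> length xs"
    and "\<And>x y. \<lbrakk>x \<in> set xs; y \<in> set ys\<rbrakk> \<Longrightarrow> x < y"
  shows "lam (shuffle xs ys ms) = graft (divide (lam xs) ms) (lam ys)"
proof -
  have "divide (lam xs) ms = map lam (pieces xs (rev ms))"
    unfolding divide_def using assms by (intro divide_rev_lam) (auto simp: sorted_wrt_rev)
  moreover have "lam (shuffle xs ys ms) = graft (map lam (pieces xs (rev ms))) (lam ys)"
    unfolding shuffle_def
  proof (rule lam_interleave)
    show "x < y" if "P \<in> set (pieces xs (rev ms))" "x \<in> set P" "y \<in> set ys" for P x y
      using assms(6) set_pieces that by blast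
  qed (use assms in auto)
  ultimately show ?thesis by simp
qed

lemma length_shuffle:
  "\<lbrakk>length ms = length ys; sorted ms; \<forall>i \<in> set ms. i \<le> length xs\<rbrakk> \<Longrightarrow>
   length (shuffle xs ys ms) = length xs + length ys"
proof (induction ys arbitrary: xs ms rule: rev_induct)
  case Nil
  then show ?case by (simp add: shuffle_def)
next
  case (snoc y ys)
  then obtain ns i where "ms = ns @ [i]" by (cases ms rule: rev_cases) auto
  then show ?case using snoc by (auto simp: shuffle_snoc sorted_append)
qed

lemma filter_shuffle:
  "\<lbrakk>length ms = length ys; \<forall>x \<in> set xs. P x; \<forall>y \<in> set ys. \<not> P y\<rbrakk> \<Longrightarrow>
   filter P (shuffle xs ys ms) = xs \<and> filter (\<lambda>z. \<not> P z) (shuffle xs ys ms) = ys"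
proof (induction ys arbitrary: xs ms rule: rev_induct)
  case Nil
  then show ?case by (simp add: shuffle_def)
next
  case (snoc y ys)
  then obtain ns i where ms: "ms = ns @ [i]" by (cases ms rule: rev_cases) auto
  have "\<forall>x \<in> set (take i xs). P x" "\<forall>x \<in> set (drop i xs). P x"
    using snoc.prems by (auto dest: in_set_takeD in_set_dropD)
  then show ?case using snoc.IH[of ns "take i xs"] snoc.prems ms by (simp add: shuffle_snoc)
qed

lemma shuffle_positions:
  "\<lbrakk>length ms = length ys; sorted ms; \<forall>i \<in> set ms. i \<le> length xs;
    \<forall>x \<in> set xs. P x; \<forall>y \<in> set ys. \<not> P y; j < length xs + length ys\<rbrakk> \<Longrightarrow>
   P (shuffle xs ys ms ! j) \<longleftrightarrow> (\<forall>k < length ms. j \<noteq> ms ! k + k)"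
proof (induction ys arbitrary: xs ms j rule: rev_induct)
  case Nil
  then show ?case by (simp add: shuffle_def)
next
  case (snoc y ys)
  then obtain ns i where ms: "ms = ns @ [i]" by (cases ms rule: rev_cases) auto
  have ns: "length ns = length ys" "sorted ns" "\<forall>k \<in> set ns. k \<le> i" "i \<le> length xs"
    using snoc.prems ms by (auto simp: sorted_append)
  have P: "\<forall>x \<in> set (take i xs). P x" using snoc.prems by (auto dest: in_set_takeD)
  have len: "length (shuffle (take i xs) ys ns) = i + length ys"
    using ns by (simp add: length_shuffle)
  \<comment> \<open>The earlier letters of the second word stand before its last letter, so none of
    them falls into the tail \<open>drop i xs\<close>.\<close>
  have bound: "ns ! k + k < i + length ns" if "k < length ns" for k
    using that ns by (intro add_le_less_mono) auto
  have all: "(\<forall>k < length ms. j \<noteq> ms ! k + k) \<longleftrightarrow>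
      (\<forall>k < length ns. j \<noteq> ns ! k + k) \<and> j \<noteq> i + length ns"
    unfolding ms by (auto simp: nth_append less_Suc_eq)
  have sh: "shuffle xs (ys @ [y]) ms = shuffle (take i xs) ys ns @ y # drop i xs"
    using ms ns by (simp add: shuffle_snoc)
  consider "j < i + length ys" | "j = i + length ys" | "j > i + length ys" by linarith
  then show ?case
  proof cases
    case 1
    then show ?thesis
      using snoc.IH[of ns "take i xs" j] snoc.prems ns P all len by (simp add: sh nth_append)
  next
    case 2
    then show ?thesis using all ns snoc.prems len by (simp add: sh nth_append)
  next
    case 3
    define j' where "j' = j - (i + length ys) - 1"
    have j: "j = Suc (i + length ys + j')" using 3 by (simp add: j'_def)
    then have "shuffle xs (ys @ [y]) ms ! j = xs ! (i + j')"
      using len ns snoc.prems by (simp add: sh nth_append)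
    moreover have "P (xs ! (i + j'))" using snoc.prems(4,6) j by simp
    moreover have "\<forall>k < length ms. j \<noteq> ms ! k + k"
      using all bound 3 ns by fastforce
    ultimately show ?thesis by simp
  qed
qed

text \<open>A word is determined by its pattern of \<open>P\<close> and its two subwords.
  \<open>shuffle_positions\<close> and \<open>filter_shuffle\<close> supply these data for a
  shuffle.\<close>

lemma list_eq_by_filters:
  "\<lbrakk>map P xs = map P ys; filter P xs = filter P ys;
    filter (\<lambda>z. \<not> P z) xs = filter (\<lambda>z. \<not> P z) ys\<rbrakk> \<Longrightarrow> xs = ys"
proof (induction xs arbitrary: ys)
  case (Cons x xs)
  then obtain y ys' where "ys = y # ys'" by (cases ys) auto
  then show ?case using Cons by (auto split: if_splits)
qed auto

section \<open>The maps \<open>f_\<zeta>\<close>\<close>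

lemma pinv_nth:
  assumes "is_perm n \<zeta>" "j < n"
  shows "pinv \<zeta> ! j - 1 < n" "\<zeta> ! (pinv \<zeta> ! j - 1) = Suc j" "pinv \<zeta> ! j = Suc (pinv \<zeta> ! j - 1)"
proof -
  have len: "length \<zeta> = n" and "Suc j \<in> set \<zeta>" using assms by (auto simp: is_perm_def)
  then have "\<exists>i. i < length \<zeta> \<and> \<zeta> ! i = Suc j" by (auto simp: in_set_conv_nth)
  from LeastI_ex[OF this] show "pinv \<zeta> ! j - 1 < n" "\<zeta> ! (pinv \<zeta> ! j - 1) = Suc j"
      "pinv \<zeta> ! j = Suc (pinv \<zeta> ! j - 1)"
    using len assms(2) by (auto simp: pinv_def simp del: upt_Suc)
qed

section \<open>Permutations with at most one descent and their inverses\<close>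

context
  fixes p q :: nat and \<zeta> :: "nat list"
  assumes Sh: "\<zeta> \<in> Sh p q"
begin

lemma Sh_perm: "is_perm (p + q) \<zeta>"
  using Sh by (simp add: Sh_def)

lemma Sh_less:
  assumes "c < c'" "c' < p + q" "c' < p \<or> p \<le> c"
  shows "\<zeta> ! c < \<zeta> ! c'"
  using assms
proof (induction c')
  case (Suc d)
  have "\<not> \<zeta> ! d > \<zeta> ! Suc d"
  proof
    assume "\<zeta> ! d > \<zeta> ! Suc d"
    \<comment> \<open>Positions in \<open>Sh_def\<close> count from 1, so a descent between list
      indices \<open>d\<close> and \<open>Suc d\<close> is a descent at position
      \<open>Suc d\<close>.\<close>
    then have "Suc d = p" using Sh Suc.prems by (auto simp: Sh_def dest: spec[of _ "Suc d"])
    then show False using Suc.prems by auto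
  qed
  moreover have "\<zeta> ! d \<noteq> \<zeta> ! Suc d"
    using Sh_perm Suc.prems by (simp add: is_perm_def nth_eq_iff_index_eq)
  ultimately have "\<zeta> ! d < \<zeta> ! Suc d" by simp
  then show ?case using Suc by (cases "c = d") auto
qed simp

text \<open>The inverse of \<zeta> with places and values counted from 0. By
  \<open>pinv_word\<close>, place \<open>j\<close> of the permuted word receives the letter at
  \<open>source j\<close>.\<close>

definition source :: "nat \<Rightarrow> nat" where
  "source j = pinv \<zeta> ! j - 1"

lemma source_less: "j < p + q \<Longrightarrow> source j < p + q"
  and nth_source: "j < p + q \<Longrightarrow> \<zeta> ! source j = Suc j"
  and pinv_source: "j < p + q \<Longrightarrow> pinv \<zeta> ! j = Suc (source j)"
  using pinv_nth[OF Sh_perm] by (auto simp: source_def)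

lemma source_nth:
  assumes "c < p + q"
  shows "\<exists>j < p + q. source j = c \<and> \<zeta> ! c = Suc j"
proof -
  have "\<zeta> ! c \<in> {1..p + q}" using Sh_perm assms by (metis is_perm_def nth_mem)
  then obtain j where j: "\<zeta> ! c = Suc j" "j < p + q" by (cases "\<zeta> ! c") auto
  then have "\<zeta> ! source j = \<zeta> ! c" using nth_source by simp
  then have "source j = c"
    using Sh_perm assms source_less[OF j(2)] by (metis is_perm_def nth_eq_iff_index_eq)
  then show ?thesis using j by blast
qed

text \<open>The two disjunctions say that both letters come from the same of the two words. There
  \<zeta> increases, so its inverse keeps their order.\<close>

lemma source_less_source:
  assumes "i < j" "j < p + q" "source j < p \<or> p \<le> source i" "source i < p \<or> p \<le> source j"
  shows "source i < source j"
proof (rule ccontr)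
  assume "\<not> source i < source j"
  then consider "source i = source j" | "source j < source i" by linarith
  then show False
  proof cases
    case 1
    then show ?thesis using nth_source[of i] nth_source[of j] assms by simp
  next
    case 2
    then have "\<zeta> ! source j < \<zeta> ! source i"
      using assms by (intro Sh_less) (auto intro: source_less)
    then show ?thesis using assms by (simp add: nth_source)
  qed
qed

lemma pinv_word:
  "pcomp xs (pinv \<zeta>) = map (\<lambda>j. xs ! source j) [0..<p + q]"
  using Sh_perm pinv_source
  by (intro nth_equalityI) (auto simp: pcomp_def pinv_def is_perm_def simp del: upt_Suc)

lemma inj_source: "inj_on source {0..<p + q}"
  by (rule inj_onI) (metis atLeastLessThan_iff nat.inject nth_source)

text \<open>Letters of \<open>ys\<close> are larger, so a run of letters smaller than one of
  \<open>xs\<close> stays within \<open>xs\<close>. There it is a run of \<open>xs\<close> itself,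
  measured by an entry of \<open>lam xs\<close>.\<close>

lemma word_run_left:
  assumes "distinct xs" "length xs = p" "\<And>x y. \<lbrakk>x \<in> set xs; y \<in> set ys\<rbrakk> \<Longrightarrow> x < y"
    and "length ys = q" "j < p + q" "source j < p"
  shows "(\<forall>i \<in> {k..<j}. (xs @ ys) ! source i < (xs @ ys) ! source j) \<longleftrightarrow>
    (\<forall>i \<in> {k..<j}. source i < p \<and> source j \<le> source i + lsizes (lam xs) ! source j)"
    (is "?L \<longleftrightarrow> ?R")
proof
  assume L: ?L
  show ?R
  proof
    fix i assume i: "i \<in> {k..<j}"
    have ip: "source i < p"
    proof (rule ccontr)
      assume "\<not> source i < p"
      then have "(xs @ ys) ! source i \<in> set ys"
        using assms i source_less[of i] by (auto simp: nth_append)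
      moreover have "(xs @ ys) ! source j \<in> set xs" using assms by (auto simp: nth_append)
      ultimately show False using assms(3) L i by (meson order_less_asym)
    qed
    have "\<forall>c \<in> {source i..<source j}. xs ! c < xs ! source j"
    proof
      \<comment> \<open>As \<open>xs\<close> keeps its order, a letter between two of its letters
        stands between them after permuting too, and so belongs to the run.\<close>
      fix c assume c: "c \<in> {source i..<source j}"
      then obtain i' where i': "i' < p + q" "source i' = c"
        using source_nth[of c] assms by auto
      have "i' < j"
        using source_less_source[of j i'] i' c assms(6) by (cases i' j rule: linorder_cases) auto
      moreover have "i \<le> i'"
        using source_less_source[of i' i] i' c assms(6) i ip assms(5) by (cases i' i rule: linorder_cases) auto
      ultimately have "(xs @ ys) ! source i' < (xs @ ys) ! source j" using L i by auto
      then show "xs ! c < xs ! source j" using i' c assms by (simp add: nth_append)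
    qed
    then have "source j \<le> source i + lsizes (lam xs) ! source j"
      using lsizes_lam[of xs "source i" "source j"] assms i ip source_less_source[of i j] by auto
    with ip show "source i < p \<and> source j \<le> source i + lsizes (lam xs) ! source j" by simp
  qed
next
  assume R: ?R
  show ?L
  proof
    fix i assume i: "i \<in> {k..<j}"
    then have "source i < p" "source j \<le> source i + lsizes (lam xs) ! source j" using R by auto
    moreover from this have "source i < source j" using source_less_source[of i j] i assms by auto
    ultimately have "xs ! source i < xs ! source j"
      using lsizes_lam[of xs "source i" "source j"] assms by auto
    then show "(xs @ ys) ! source i < (xs @ ys) ! source j"
      using \<open>source i < p\<close> assms by (simp add: nth_append)
  qed
qed

text \<open>Letters of \<open>xs\<close> are smaller and never break a run that ends at a letter of
  \<open>ys\<close>. Only the letters of \<open>ys\<close> impose a condition, with indices shifted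
  by \<open>p\<close>.\<close>

lemma word_run_right:
  assumes "distinct ys" "length ys = q" "\<And>x y. \<lbrakk>x \<in> set xs; y \<in> set ys\<rbrakk> \<Longrightarrow> x < y"
    and "length xs = p" "j < p + q" "p \<le> source j"
  shows "(\<forall>i \<in> {k..<j}. (xs @ ys) ! source i < (xs @ ys) ! source j) \<longleftrightarrow>
    (\<forall>i \<in> {k..<j}. p \<le> source i \<longrightarrow>
       source j - p \<le> (source i - p) + lsizes (lam ys) ! (source j - p))"
    (is "?L \<longleftrightarrow> ?R")
proof
  assume L: ?L
  show ?R
  proof (intro ballI impI)
    fix i assume i: "i \<in> {k..<j}" and ip: "p \<le> source i"
    have "\<forall>c \<in> {source i - p..<source j - p}. ys ! c < ys ! (source j - p)"
    proof
      fix c assume c: "c \<in> {source i - p..<source j - p}"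
      then have "c + p < p + q" using source_less[of j] assms by auto
      then obtain i' where i': "i' < p + q" "source i' = c + p" using source_nth[of "c + p"] by auto
      have "i' < j"
        using source_less_source[of j i'] i' c assms(6) by (cases i' j rule: linorder_cases) auto
      moreover have "i \<le> i'"
        using source_less_source[of i' i] i' c assms(5) i ip by (cases i' i rule: linorder_cases) auto
      ultimately have "(xs @ ys) ! source i' < (xs @ ys) ! source j" using L i by auto
      then show "ys ! c < ys ! (source j - p)" using i' assms by (simp add: nth_append)
    qed
    then show "source j - p \<le> (source i - p) + lsizes (lam ys) ! (source j - p)"
      using lsizes_lam[of ys "source i - p" "source j - p"] assms i ip
        source_less_source[of i j] source_less[of j] by auto
  qed
next
  assume R: ?R
  show ?L
  proof
    fix i assume i: "i \<in> {k..<j}"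
    have jq: "source j - p < q" using source_less[of j] assms by auto
    show "(xs @ ys) ! source i < (xs @ ys) ! source j"
    proof (cases "p \<le> source i")
      case True
      then have "source j - p \<le> source i - p + lsizes (lam ys) ! (source j - p)" using R i by auto
      moreover have "source i < source j" using source_less_source[of i j] i assms True by auto
      ultimately have "ys ! (source i - p) < ys ! (source j - p)"
        using lsizes_lam[of ys "source i - p" "source j - p"] assms True jq by auto
      then show ?thesis using True assms by (simp add: nth_append)
    next
      case False
      then have "(xs @ ys) ! source i \<in> set xs" using assms by (simp add: nth_append)
      moreover have "(xs @ ys) ! source j \<in> set ys" using assms jq by (simp add: nth_append)
      ultimately show ?thesis using assms(3) by blast
    qed
  qed
qed

section \<open>The pairs that \<open>f_zeta\<close> sends below a given tree\<close>

lemma f_zeta_word: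
  assumes "s \<in> Y p" "t \<in> Y q"
  shows "f_zeta \<zeta> s t =
    lam (map (\<lambda>j. (gamma s @ map (\<lambda>x. x + p) (gamma t)) ! source j) [0..<p + q])"
  using assms by (simp add: f_zeta_def pinv_word slash_def Y_def)

lemma shifted_gamma:
  assumes "s \<in> Y p" "t \<in> Y q"
  defines "ys \<equiv> map (\<lambda>x. x + p) (gamma t)"
  shows "length (gamma s) = p" "length ys = q" "distinct ys" "lam ys = t"
    "\<And>x y. \<lbrakk>x \<in> set (gamma s); y \<in> set ys\<rbrakk> \<Longrightarrow> x < y"
proof -
  have "lam ys = lam (gamma t)"
    unfolding ys_def by (rule lam_map) (auto intro: strict_mono_onI)
  then show "lam ys = t" by simp
qed (use assms in \<open>auto simp: Y_def ys_def distinct_map set_gamma\<close>)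

lemma distinct_word:
  assumes "distinct W" "length W = p + q"
  shows "distinct (map (\<lambda>j. W ! source j) [0..<p + q])"
proof -
  have "inj_on ((!) W) (source ` {0..<p + q})"
    using assms source_less by (intro inj_on_nth) auto
  from comp_inj_on[OF inj_source this] show ?thesis by (simp add: distinct_map comp_def)
qed

lemma f_zeta_in_Y:
  assumes "s \<in> Y p" "t \<in> Y q"
  shows "f_zeta \<zeta> s t \<in> Y (p + q)"
proof -
  note g = shifted_gamma[OF assms]
  have "distinct (gamma s @ map (\<lambda>x. x + p) (gamma t))"
    using g(3,5) by (auto; fastforce)
  from distinct_word[OF this] show ?thesis
    using g by (simp add: f_zeta_word[OF assms] Y_def nodes_lam)
qed

text \<open>Each requirement that \<open>r\<close> puts on a pair of places falls into one of three
  kinds. If the later letter is from the first word, the earlier one must be too (\<open>C\<close>,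
  free of \<open>s\<close> and \<open>t\<close>), and an entry of \<open>s\<close> is bounded
  (\<open>R1\<close>). If both are from the second word, an entry of \<open>t\<close> is bounded
  (\<open>R2\<close>). The remaining case holds automatically.\<close>

lemma f_zeta_le_iff:
  assumes "r \<in> Y (p + q)"
  obtains C R1 R2 where "\<And>s t. \<lbrakk>s \<in> Y p; t \<in> Y q\<rbrakk> \<Longrightarrow> tamari_le (f_zeta \<zeta> s t) r \<longleftrightarrow>
    C \<and> (\<forall>k j. j < p \<and> R1 k j \<longrightarrow> j \<le> k + lsizes s ! j) \<and>
        (\<forall>k j. j < q \<and> R2 k j \<longrightarrow> j \<le> k + lsizes t ! j)"
proof -
  \<comment> \<open>\<open>run i j\<close> says that node \<open>i\<close> lies in the left subtree
    of node \<open>j\<close> of \<open>r\<close>.\<close>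
  define run where "run i j \<longleftrightarrow> j < p + q \<and> (\<exists>k \<le> j. j \<le> k + lsizes r ! j \<and> i \<in> {k..<j})" for i j
  define C where "C \<longleftrightarrow> (\<forall>i j. run i j \<and> source j < p \<longrightarrow> source i < p)"
  define R1 where "R1 a b \<longleftrightarrow> (\<exists>i j. run i j \<and> source i = a \<and> source j = b)" for a b
  define R2 where "R2 a b \<longleftrightarrow> (\<exists>i j. run i j \<and> source i = p + a \<and> source j = p + b)" for a b
  have "tamari_le (f_zeta \<zeta> s t) r \<longleftrightarrow>
    C \<and> (\<forall>k j. j < p \<and> R1 k j \<longrightarrow> j \<le> k + lsizes s ! j) \<and>
        (\<forall>k j. j < q \<and> R2 k j \<longrightarrow> j \<le> k + lsizes t ! j)"
    if st: "s \<in> Y p" "t \<in> Y q" for s t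
  proof -
    define W where "W = gamma s @ map (\<lambda>x. x + p) (gamma t)"
    define w where "w = map (\<lambda>j. W ! source j) [0..<p + q]"
    note g = shifted_gamma[OF st]
    have "distinct W" unfolding W_def using g(3,5) by (auto; fastforce)
    then have dw: "distinct w" "length w = p + q"
      using distinct_word[of W] g by (auto simp: w_def W_def)
    have f: "f_zeta \<zeta> s t = lam w" unfolding w_def W_def by (rule f_zeta_word[OF st])
    \<comment> \<open>For \<open>i < j\<close>, \<open>good i j\<close> implies that the letter at
      \<open>i\<close> is below that at \<open>j\<close>. The two conditions become equivalent when
      taken over a whole interval that ends just before \<open>j\<close>.\<close>
    define good where "good i j \<longleftrightarrow> 
      (if source j < p then source i < p \<and> source j \<le> source i + lsizes s ! source j
       else p \<le> source i \<longrightarrow> source j - p \<le> (source i - p) + lsizes t ! (source j - p))" for i j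
    have *: "j \<le> k + lsizes (lam w) ! j \<longleftrightarrow> (\<forall>i \<in> {k..<j}. good i j)"
      if kj: "k \<le> j" "j < p + q" for k j
    proof -
      have "j \<le> k + lsizes (lam w) ! j \<longleftrightarrow> (\<forall>i \<in> {k..<j}. w ! i < w ! j)"
        using lsizes_lam[OF dw(1) kj(1)] kj(2) dw(2) by simp
      also have "\<dots> \<longleftrightarrow> (\<forall>i \<in> {k..<j}. W ! source i < W ! source j)"
        using kj by (simp add: w_def)
      also have "\<dots> \<longleftrightarrow> (\<forall>i \<in> {k..<j}. good i j)"
      proof (cases "source j < p")
        case True
        then show ?thesis
          using word_run_left[OF distinct_gamma g(1,5,2) kj(2) True, of k]
          by (simp add: W_def good_def)
      next
        case False
        then have "p \<le> source j" by simp
        from word_run_right[OF g(3,2,5,1) kj(2) this, of k] show ?thesis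
          using g(4) False by (simp add: W_def good_def)
      qed
      finally show ?thesis .
    qed
    have "tamari_le (f_zeta \<zeta> s t) r \<longleftrightarrow>
        (\<forall>j < p + q. \<forall>k \<le> j. j \<le> k + lsizes r ! j \<longrightarrow> j \<le> k + lsizes (lam w) ! j)"
      unfolding tamari_le_iff f using assms nodes_lam[OF dw(1)] dw(2) by (simp add: Y_def)
    also have "\<dots> \<longleftrightarrow> (\<forall>i j. run i j \<longrightarrow> good i j)"
      using * unfolding run_def by blast
    also have "\<dots> \<longleftrightarrow> C \<and> (\<forall>k j. j < p \<and> R1 k j \<longrightarrow> j \<le> k + lsizes s ! j) \<and>
        (\<forall>k j. j < q \<and> R2 k j \<longrightarrow> j \<le> k + lsizes t ! j)" (is "?L \<longleftrightarrow> ?R")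
    proof
      assume L: ?L
      show ?R
      proof (intro conjI allI impI)
        show C unfolding C_def using L by (auto simp: good_def)
        show "j \<le> k + lsizes s ! j" if "j < p \<and> R1 k j" for k j
          using L that by (auto simp: good_def R1_def)
        show "j \<le> k + lsizes t ! j" if "j < q \<and> R2 k j" for k j
        proof -
          obtain i' j' where "run i' j'" "source i' = p + k" "source j' = p + j"
            using \<open>j < q \<and> R2 k j\<close> unfolding R2_def by blast
          moreover have "good i' j'" using L \<open>run i' j'\<close> by blast
          ultimately show ?thesis by (simp add: good_def)
        qed
      qed
    next
      assume R: ?R
      show ?L
      proof (intro allI impI)
        fix i j assume ij: "run i j"
        show "good i j"
        proof (cases "source j < p")
          case True
          then have "R1 (source i) (source j)" "source i < p"
            using R ij unfolding C_def R1_def by blast+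
          then show ?thesis using R True unfolding good_def by simp
        next
          case False
          have "source j - p < q" using False ij source_less[of j] by (auto simp: run_def)
          moreover have "R2 (source i - p) (source j - p)" if "p \<le> source i"
            using ij that False unfolding R2_def by (intro exI[of _ i] exI[of _ j]) auto
          ultimately have "p \<le> source i \<longrightarrow>
              source j - p \<le> (source i - p) + lsizes t ! (source j - p)"
            using R by blast
          then show ?thesis using False by (simp only: good_def if_False)
        qed
      qed
    qed
    finally show ?thesis .
  qed
  then show thesis by (rule that)
qed

text \<open>One element of \<open>A\<close> already forces \<open>C\<close>. The other conditions
  concern \<open>s\<close> and \<open>t\<close> separately, so \<open>A\<close> is a product, and
  \<open>tamari_principal_ideal\<close> applies to each factor.\<close>

lemma f_zeta_preimage:
  assumes "r \<in> Y (p + q)"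
  defines "A \<equiv> {(s, t) \<in> Y p \<times> Y q. tamari_le (f_zeta \<zeta> s t) r}"
  assumes "A \<noteq> {}"
  shows "\<exists>m \<in> Y p. \<exists>m' \<in> Y q. A = {s. tamari_le s m} \<times> {t. tamari_le t m'}"
proof -
  obtain C R1 R2 where iff: "\<And>s t. \<lbrakk>s \<in> Y p; t \<in> Y q\<rbrakk> \<Longrightarrow> tamari_le (f_zeta \<zeta> s t) r \<longleftrightarrow>
    C \<and> (\<forall>k j. j < p \<and> R1 k j \<longrightarrow> j \<le> k + lsizes s ! j) \<and>
        (\<forall>k j. j < q \<and> R2 k j \<longrightarrow> j \<le> k + lsizes t ! j)"
    using f_zeta_le_iff[OF assms(1)] by blast
  define S1 where "S1 = {s \<in> Y p. \<forall>k j. j < p \<and> R1 k j \<longrightarrow> j \<le> k + lsizes s ! j}"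
  define S2 where "S2 = {t \<in> Y q. \<forall>k j. j < q \<and> R2 k j \<longrightarrow> j \<le> k + lsizes t ! j}"
  have "C" using assms(3) iff by (auto simp: A_def)
  then have A: "A = S1 \<times> S2" using iff by (auto simp: A_def S1_def S2_def)
  then have "S1 \<noteq> {}" "S2 \<noteq> {}" using assms(3) by auto
  then obtain m m' where "m \<in> Y p" "S1 = {s. tamari_le s m}" "m' \<in> Y q" "S2 = {t. tamari_le t m'}"
    using tamari_principal_ideal[of p R1] tamari_principal_ideal[of q R2]
    unfolding S1_def S2_def by blast
  then show ?thesis unfolding A by blast
qed

text \<open>\<open>\<zeta> ! (p + k)\<close> is the place, counted from 1, of letter
  \<open>k\<close> of the second word. Removing that 1 and the \<open>k\<close> earlier letters of
  the second word leaves the number of letters of the first word before it.\<close>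

definition cuts :: "nat list" where
  "cuts = map (\<lambda>k. \<zeta> ! (p + k) - Suc k) [0..<q]"

lemma Sh_le: "\<lbrakk>k \<le> k'; k' < q\<rbrakk> \<Longrightarrow> \<zeta> ! (p + k) + (k' - k) \<le> \<zeta> ! (p + k')"
proof (induction k')
  case (Suc k')
  have "\<zeta> ! (p + k') < \<zeta> ! (p + Suc k')" using Suc.prems by (intro Sh_less) auto
  then show ?case using Suc by (cases "k = Suc k'") auto
qed simp

text \<open>The lower bound keeps the subtraction in \<open>cuts\<close> from being truncated, and
  the upper bound makes each cut a leaf number.\<close>

lemma Sh_bounds:
  assumes "k < q"
  shows "Suc k \<le> \<zeta> ! (p + k)" "\<zeta> ! (p + k) \<le> p + Suc k"
proof -
  have *: "\<zeta> ! (p + i) \<in> {1..p + q}" if "i < q" for i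
    using Sh_perm that by (metis is_perm_def nth_mem nat_add_left_cancel_less)
  show "Suc k \<le> \<zeta> ! (p + k)" using Sh_le[of 0 k] *[of 0] assms by auto
  have "k \<le> q - 1" "q - 1 < q" using assms by auto
  then show "\<zeta> ! (p + k) \<le> p + Suc k" using Sh_le[of k "q - 1"] *[of "q - 1"] by auto
qed

lemma length_cuts: "length cuts = q"
  by (simp add: cuts_def)

lemma cuts_nth: "k < q \<Longrightarrow> \<zeta> ! (p + k) = Suc (cuts ! k + k)"
  using Sh_bounds(1)[of k] by (simp add: cuts_def)

lemma cuts_le: "i \<in> set cuts \<Longrightarrow> i \<le> p"
  using Sh_bounds(2) by (fastforce simp: cuts_def)

lemma sorted_cuts: "sorted cuts"
  unfolding sorted_iff_nth_mono
proof (intro allI impI)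
  fix i j assume "i \<le> j" "j < length cuts"
  then show "cuts ! i \<le> cuts ! j"
    using Sh_le[of i j] cuts_nth[of i] cuts_nth[of j] by (simp add: length_cuts)
qed

lemma filter_source:
  "filter (\<lambda>c. c < p) (map source [0..<p + q]) = [0..<p]"
  "filter (\<lambda>c. \<not> c < p) (map source [0..<p + q]) = [p..<p + q]"
proof -
  have set: "set (map source [0..<p + q]) = {0..<p + q}"
    using source_nth source_less by (fastforce simp: image_iff)
  have dist: "distinct (map source [0..<p + q])" using inj_source by (simp add: distinct_map)
  have sorted: "sorted (filter P (map source [0..<p + q]))"
    if "P = (\<lambda>c. c < p) \<or> P = (\<lambda>c. \<not> c < p)" for P
  proof -
    \<comment> \<open>Sources are ordered only within one word. Restricting the relation to
      \<open>P\<close> makes it hold on the full list, and it then passes to the filtered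
      one.\<close>
    have "sorted_wrt (\<lambda>a b. P a \<and> P b \<longrightarrow> a \<le> b) (map source [0..<p + q])"
      using that source_less_source
      by (auto simp: sorted_wrt_iff_nth_less intro!: less_imp_le)
    then have "sorted_wrt (\<lambda>a b. P a \<and> P b \<longrightarrow> a \<le> b) (filter P (map source [0..<p + q]))"
      by (rule sorted_wrt_filter)
    then show ?thesis by (rule sorted_wrt_mono_rel[rotated]) auto
  qed
  show "filter (\<lambda>c. c < p) (map source [0..<p + q]) = [0..<p]"
  proof (rule sorted_distinct_set_unique)
    show "set (filter (\<lambda>c. c < p) (map source [0..<p + q])) = set [0..<p]"
      unfolding set_filter set by auto
  qed (use sorted dist in \<open>auto intro: distinct_filter\<close>)
  show "filter (\<lambda>c. \<not> c < p) (map source [0..<p + q]) = [p..<p + q]"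
  proof (rule sorted_distinct_set_unique)
    show "set (filter (\<lambda>c. \<not> c < p) (map source [0..<p + q])) = set [p..<p + q]"
      unfolding set_filter set by auto
  qed (use sorted dist in \<open>auto intro: distinct_filter\<close>)
qed

text \<open>Both sides have the subwords \<open>xs\<close> and \<open>ys\<close>, and on both the
  letters of \<open>ys\<close> occupy the places \<open>cuts ! k + k\<close>.\<close>

lemma word_eq_shuffle:
  assumes "length xs = p" "length ys = q" "\<forall>x \<in> set xs. P x" "\<forall>y \<in> set ys. \<not> P y"
  shows "map (\<lambda>j. (xs @ ys) ! source j) [0..<p + q] = shuffle xs ys cuts"
proof (rule list_eq_by_filters[where P = P])
  let ?g = "\<lambda>c. (xs @ ys) ! c" and ?w = "map (\<lambda>j. (xs @ ys) ! source j) [0..<p + q]"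
  have cuts: "length cuts = length ys" "\<forall>i \<in> set cuts. i \<le> length xs"
    using assms length_cuts cuts_le by auto
  have P: "P (?g c) \<longleftrightarrow> c < p" if "c < p + q" for c
    using assms that by (auto simp: nth_append)
  have w: "?w = map ?g (map source [0..<p + q])" by simp
  have "filter P ?w = map ?g (filter (\<lambda>c. c < p) (map source [0..<p + q]))"
    unfolding w filter_map by (intro arg_cong[where f = "map _"] filter_cong) (auto simp: P source_less)
  also have "\<dots> = xs" unfolding filter_source using assms by (intro nth_equalityI) (auto simp: nth_append)
  finally show "filter P ?w = filter P (shuffle xs ys cuts)"
    using filter_shuffle[OF cuts(1) assms(3,4)] by simp
  have "filter (\<lambda>z. \<not> P z) ?w = map ?g (filter (\<lambda>c. \<not> c < p) (map source [0..<p + q]))"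
    unfolding w filter_map by (intro arg_cong[where f = "map _"] filter_cong) (auto simp: P source_less)
  also have "\<dots> = ys" unfolding filter_source using assms by (intro nth_equalityI) (auto simp: nth_append)
  finally show "filter (\<lambda>z. \<not> P z) ?w = filter (\<lambda>z. \<not> P z) (shuffle xs ys cuts)"
    using filter_shuffle[OF cuts(1) assms(3,4)] by simp
  have len: "length (shuffle xs ys cuts) = p + q"
    using length_shuffle[OF cuts(1) sorted_cuts cuts(2)] assms by simp
  have "P (?g (source j)) \<longleftrightarrow> P (shuffle xs ys cuts ! j)" if j: "j < p + q" for j
  proof -
    have "P (?g (source j)) \<longleftrightarrow> source j < p" using P source_less j by simp
    also have "\<dots> \<longleftrightarrow> (\<forall>k < q. j \<noteq> cuts ! k + k)"
    proof
      assume "source j < p"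
      show "\<forall>k < q. j \<noteq> cuts ! k + k"
      proof (intro allI impI notI)
        fix k assume k: "k < q" "j = cuts ! k + k"
        then have "\<zeta> ! source j = \<zeta> ! (p + k)" using cuts_nth nth_source j by simp
        then have "source j = p + k"
          using Sh_perm source_less[OF j] k by (metis is_perm_def nth_eq_iff_index_eq nat_add_left_cancel_less)
        then show False using \<open>source j < p\<close> by simp
      qed
    next
      assume no: "\<forall>k < q. j \<noteq> cuts ! k + k"
      show "source j < p"
      proof (rule ccontr)
        assume ge: "\<not> source j < p"
        then have k: "source j - p < q" "source j = p + (source j - p)"
          using source_less[OF j] by auto
        have "Suc j = Suc (cuts ! (source j - p) + (source j - p))"
          using cuts_nth[OF k(1)] k(2) nth_source[OF j] by simp
        then show False using no k(1) by blast
      qed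
    qed
    also have "\<dots> \<longleftrightarrow> P (shuffle xs ys cuts ! j)"
      using shuffle_positions[OF cuts(1) sorted_cuts cuts(2) assms(3,4), of j] assms j length_cuts
      by simp
    finally show ?thesis .
  qed
  then show "map P ?w = map P (shuffle xs ys cuts)"
    using len by (intro nth_equalityI) auto
qed

text \<open>Identifies \<open>f_zeta \<zeta> s t\<close> with the summand of the product for the
  multiset \<open>cuts\<close>.\<close>

lemma f_zeta_eq_graft:
  assumes "s \<in> Y p" "t \<in> Y q"
  shows "f_zeta \<zeta> s t = graft (divide s cuts) t"
proof -
  note g = shifted_gamma[OF assms]
  let ?ys = "map (\<lambda>x. x + p) (gamma t)"
  have "f_zeta \<zeta> s t = lam (shuffle (gamma s) ?ys cuts)"
    unfolding f_zeta_word[OF assms]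
    using assms g by (subst word_eq_shuffle[where P = "\<lambda>x. x \<le> p"]) (auto simp: set_gamma Y_def)
  also have "\<dots> = graft (divide (lam (gamma s)) cuts) (lam ?ys)"
    using g by (intro lam_shuffle sorted_cuts) (simp_all add: length_cuts cuts_le)
  finally show ?thesis using g by simp
qed

end

text \<open>The cuts give the last \<open>q\<close> values, and the first \<open>p\<close> are the
  remaining values in increasing order. Conversely, adding \<open>k + 1\<close> to
  \<open>ms ! k\<close> makes a sorted list strictly increasing, and it can serve as the last
  \<open>q\<close> values.\<close>

lemma bij_betw_cuts:
  "bij_betw (cuts p q) (Sh p q) {ms. sorted ms \<and> length ms = q \<and> (\<forall>i \<in> set ms. i \<le> p)}"
    (is "bij_betw _ _ ?T")
  unfolding bij_betw_def
proof
  show "inj_on (cuts p q) (Sh p q)"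
  proof (rule inj_onI)
    fix \<zeta> \<xi> assume \<zeta>: "\<zeta> \<in> Sh p q" and \<xi>: "\<xi> \<in> Sh p q" and eq: "cuts p q \<zeta> = cuts p q \<xi>"
    note perm = Sh_perm[OF \<zeta>] Sh_perm[OF \<xi>]
    have drop: "drop p \<zeta> = drop p \<xi>"
      using perm cuts_nth[OF \<zeta>] cuts_nth[OF \<xi>] eq
      by (intro nth_equalityI) (auto simp: is_perm_def)
    have take: "sorted (take p \<zeta>)" "distinct (take p \<zeta>)"
      "set (take p \<zeta>) = {1..p + q} - set (drop p \<zeta>)" if "\<zeta> \<in> Sh p q" for \<zeta>
    proof -
      note perm = Sh_perm[OF that]
      show "sorted (take p \<zeta>)"
        unfolding sorted_wrt_iff_nth_less using perm
        by (auto simp: is_perm_def intro!: less_imp_le Sh_less[OF that])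
      show "distinct (take p \<zeta>)" using perm by (simp add: is_perm_def)
      have "set \<zeta> = set (take p \<zeta>) \<union> set (drop p \<zeta>)" by (metis append_take_drop_id set_append)
      moreover have "set (take p \<zeta>) \<inter> set (drop p \<zeta>) = {}"
        using perm by (metis append_take_drop_id distinct_append is_perm_def)
      ultimately show "set (take p \<zeta>) = {1..p + q} - set (drop p \<zeta>)"
        using perm by (auto simp: is_perm_def)
    qed
    have "take p \<zeta> = take p \<xi>"
      using take[OF \<zeta>] take[OF \<xi>] drop by (intro sorted_distinct_set_unique) auto
    with drop show "\<zeta> = \<xi>" by (metis append_take_drop_id)
  qed
next
  show "cuts p q ` Sh p q = ?T"
  proof
    show "cuts p q ` Sh p q \<subseteq> ?T"
      using sorted_cuts length_cuts cuts_le by auto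
    show "?T \<subseteq> cuts p q ` Sh p q"
    proof
      fix ms assume "ms \<in> ?T"
      then have ms: "sorted ms" "length ms = q" "\<And>i. i \<in> set ms \<Longrightarrow> i \<le> p" by auto
      define b where "b = map (\<lambda>k. Suc (ms ! k + k)) [0..<q]"
      define a where "a = sorted_list_of_set ({1..p + q} - set b)"
      have b_less: "b ! i < b ! j" if "i < j" "j < q" for i j
        using sorted_nth_mono[OF ms(1), of i j] that ms(2) by (simp add: b_def)
      have "length b = q" by (simp add: b_def)
      have "sorted_wrt (<) b" unfolding sorted_wrt_iff_nth_less using b_less by (simp add: b_def)
      then have "distinct b" by (simp add: strict_sorted_iff)
      have "set b \<subseteq> {1..p + q}"
      proof
        fix x assume "x \<in> set b"
        then obtain k where "k < q" "x = Suc (ms ! k + k)" by (auto simp: b_def)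
        moreover have "ms ! k \<le> p" using ms \<open>k < q\<close> by simp
        ultimately show "x \<in> {1..p + q}" by simp
      qed
      have a: "set a = {1..p + q} - set b" "distinct a" "sorted_wrt (<) a"
        by (auto simp: a_def)
      have "length a = p"
        using \<open>set b \<subseteq> {1..p + q}\<close> \<open>distinct b\<close> \<open>length b = q\<close> distinct_card[of b]
        by (simp add: a_def card_Diff_subset)
      have Sh: "a @ b \<in> Sh p q"
        unfolding Sh_def mem_Collect_eq
      proof (intro conjI allI impI)
        show "is_perm (p + q) (a @ b)"
          using a \<open>length a = p\<close> \<open>length b = q\<close> \<open>distinct b\<close> \<open>set b \<subseteq> {1..p + q}\<close>
          by (auto simp: is_perm_def)
        fix i assume i: "1 \<le> i \<and> i < p + q \<and> (a @ b) ! i < (a @ b) ! (i - 1)"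
        show "i = p"
        proof (rule ccontr)
          assume "i \<noteq> p"
          then consider "i < p" | "p < i" by linarith
          then have "(a @ b) ! (i - 1) < (a @ b) ! i"
          proof cases
            case 1
            then show ?thesis
              using sorted_wrt_nth_less[OF a(3), of "i - 1" i] i \<open>length a = p\<close>
              by (simp add: nth_append less_imp_diff_less)
          next
            case 2
            then have "\<not> i - 1 < p" "i - 1 - p < i - p" "i - p < q" using i by auto
            then show ?thesis
              using b_less[of "i - 1 - p" "i - p"] 2 \<open>length a = p\<close> by (simp add: nth_append)
          qed
          then show False using i by simp
        qed
      qed
      have "cuts p q (a @ b) = ms"
        unfolding cuts_def[OF Sh] using \<open>length a = p\<close> ms(2)
        by (intro nth_equalityI) (auto simp: nth_append b_def)
      with Sh show "ms \<in> cuts p q ` Sh p q" by blast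
    qed
  qed
qed

lemma Fprod_eq_card:
  assumes "s \<in> Y p" "t \<in> Y q"
  shows "Fprod s t r = of_nat (card {\<zeta> \<in> Sh p q. f_zeta \<zeta> s t = r})"
proof -
  let ?T = "{ms. sorted ms \<and> length ms = q \<and> (\<forall>i \<in> set ms. i \<le> p)}"
  have img: "cuts p q ` Sh p q = ?T" and inj: "inj_on (cuts p q) (Sh p q)"
    using bij_betw_cuts by (auto simp: bij_betw_def)
  have "{ms. sorted ms \<and> length ms = nodes t \<and> (\<forall>i \<in> set ms. i \<le> nodes s) \<and>
      graft (divide s ms) t = r} = {ms \<in> ?T. graft (divide s ms) t = r}"
    using assms by (auto simp: Y_def)
  also have "\<dots> = cuts p q ` {\<zeta> \<in> Sh p q. f_zeta \<zeta> s t = r}"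
    unfolding img[symmetric] using f_zeta_eq_graft[OF _ assms] by auto
  finally show ?thesis
    unfolding Fprod_def using inj_on_subset[OF inj, of "{\<zeta> \<in> Sh p q. f_zeta \<zeta> s t = r}"]
    by (simp add: card_image)
qed

lemma finite_Sh [simp]: "finite (Sh p q)"
proof (rule finite_subset)
  show "Sh p q \<subseteq> {xs. set xs \<subseteq> {1..p + q} \<and> length xs = p + q}"
    by (auto simp: Sh_def is_perm_def)
qed (rule finite_lists_length_eq, simp)

section \<open>Moebius inversion\<close>

lemma card_interval_less:
  assumes "tamari_le x z" "tamari_le z y" "z \<noteq> y"
  shows "card {u. tamari_le x u \<and> tamari_le u z} < card {u. tamari_le x u \<and> tamari_le u y}"
proof (rule psubset_card_mono)
  show "finite {u. tamari_le x u \<and> tamari_le u y}"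
    by (rule finite_subset[OF _ finite_tamari_down[of y]]) auto
  show "{u. tamari_le x u \<and> tamari_le u z} \<subset> {u. tamari_le x u \<and> tamari_le u y}"
    using assms tamari_le_antisym[of z y] tamari_le_trans[of _ z y] tamari_le_trans[of x z y]
      tamari_le_refl[of y] by blast
qed

text \<open>Recursive calls go to strictly smaller intervals, so a bound of at least the interval
  size does not run out.\<close>

lemma mob_bound_irrelevant:
  assumes "tamari_le x y"
    and "card {z. tamari_le x z \<and> tamari_le z y} \<le> k"
    and "card {z. tamari_le x z \<and> tamari_le z y} \<le> k'"
  shows "mob k x y = mob k' x y"
  using assms
proof (induction k arbitrary: k' y)
  case 0
  have fin: "finite {z. tamari_le x z \<and> tamari_le z y}"
    by (rule finite_subset[OF _ finite_tamari_down[of y]]) auto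
  have "x \<in> {z. tamari_le x z \<and> tamari_le z y}" using 0 by simp
  then show ?case using 0 fin by (metis (no_types, lifting) card_0_eq empty_iff le_zero_eq)
next
  case (Suc k)
  have fin: "finite {z. tamari_le x z \<and> tamari_le z y}"
    by (rule finite_subset[OF _ finite_tamari_down[of y]]) auto
  have "x \<in> {z. tamari_le x z \<and> tamari_le z y}" using Suc.prems by simp
  then obtain l where l: "k' = Suc l"
    using Suc.prems(3) fin by (metis (no_types, lifting) card_0_eq empty_iff le_zero_eq not0_implies_Suc)
  have "mob k x z = mob l x z" if "tamari_le x z \<and> tamari_le z y \<and> z \<noteq> y" for z
    using card_interval_less[of x z y] that Suc.prems(2,3) l by (intro Suc.IH) auto
  then show ?case using l by (auto intro!: sum.cong)
qed

text \<open>This is the recursion of \<open>mob\<close>, once \<open>mob_bound_irrelevant\<close>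
  has aligned the bounds that \<open>mobius\<close> uses for different \<open>z\<close>.\<close>

lemma sum_mobius:
  assumes "tamari_le x y"
  shows "(\<Sum>z \<in> {z. tamari_le x z \<and> tamari_le z y}. mobius x z) = (if x = y then 1 else 0)"
proof -
  let ?I = "{z. tamari_le x z \<and> tamari_le z y}" and ?J = "{z. tamari_le x z \<and> tamari_le z y \<and> z \<noteq> y}"
  have fin: "finite ?I" by (rule finite_subset[OF _ finite_tamari_down[of y]]) auto
  have "card ?I > 0" using assms fin by (auto simp: card_gt_0_iff)
  then obtain k where k: "card ?I = Suc k" using gr0_implies_Suc by blast
  show ?thesis
  proof (cases "x = y")
    case True
    then have "?I = {y}" using tamari_le_antisym by auto
    then show ?thesis using True by (simp add: mobius_def)
  next
    case False
    have "mobius x y = - (\<Sum>z \<in> ?J. mob k x z)"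
      using False assms k by (simp add: mobius_def)
    also have "(\<Sum>z \<in> ?J. mob k x z) = (\<Sum>z \<in> ?J. mobius x z)"
      unfolding mobius_def
    proof (intro sum.cong refl mob_bound_irrelevant)
      fix z assume "z \<in> ?J"
      then show "card {u. tamari_le x u \<and> tamari_le u z} \<le> k"
        using card_interval_less[of x z y] k by auto
    qed auto
    finally have "mobius x y + (\<Sum>z \<in> ?J. mobius x z) = 0" by simp
    moreover have "?I = insert y ?J" using assms by auto
    moreover have "finite ?J" by (rule finite_subset[OF _ fin]) auto
    ultimately show ?thesis using False by simp
  qed
qed

lemma M_eq: "M s u = (if tamari_le s u then of_int (mobius s u) else 0)"
proof -
  have "M s u = (\<Sum>r \<in> {r. tamari_le s r}. if r = u then of_int (mobius s u) else 0)"
    unfolding M_def F_def by (intro sum.cong) auto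
  then show ?thesis by simp
qed

lemma sum_M_below: "(\<Sum>u \<in> {u. tamari_le u w}. M r u) = (if r = w then 1 else 0)"
proof -
  have "(\<Sum>u \<in> {u. tamari_le u w}. M r u) =
      (\<Sum>u \<in> {u. tamari_le r u \<and> tamari_le u w}. of_int (mobius r u))"
    by (intro sum.mono_neutral_cong_right) (auto simp: M_eq)
  also have "\<dots> = (if r = w then 1 else 0)"
  proof (cases "tamari_le r w")
    case True
    have "(\<Sum>u \<in> {u. tamari_le r u \<and> tamari_le u w}. of_int (mobius r u) :: rat) =
        of_int (\<Sum>u \<in> {u. tamari_le r u \<and> tamari_le u w}. mobius r u)" by simp
    then show ?thesis unfolding sum_mobius[OF True] by simp
  next
    case False
    then have empty: "{u. tamari_le r u \<and> tamari_le u w} = {}" using tamari_le_trans by blast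
    have "r \<noteq> w" using False by auto
    then show ?thesis unfolding empty by simp
  qed
  finally show ?thesis .
qed

text \<open>By induction on the size of the principal ideal, \<open>a\<close> and \<open>b\<close>
  agree strictly below \<open>w\<close>, which leaves only the terms at \<open>w\<close>.\<close>

lemma eq_of_sums_below:
  fixes a b :: "tree \<Rightarrow> 'a :: ab_group_add"
  assumes "\<And>w. (\<Sum>u \<in> {u. tamari_le u w}. a u) = (\<Sum>u \<in> {u. tamari_le u w}. b u)"
  shows "a = b"
proof
  fix w show "a w = b w"
  proof (induction "card {u. tamari_le u w}" arbitrary: w rule: less_induct)
    case less
    let ?D = "{u. tamari_le u w}"
    have "a u = b u" if "u \<in> ?D - {w}" for u
    proof (rule less)
      have "{v. tamari_le v u} \<subset> ?D"
        using that tamari_le_antisym[of u w] tamari_le_trans[of _ u w] tamari_le_refl[of w] by blast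
      then show "card {v. tamari_le v u} < card ?D" by (intro psubset_card_mono) auto
    qed
    then have "sum a (?D - {w}) = sum b (?D - {w})" by (intro sum.cong) auto
    moreover have "sum a ?D = a w + sum a (?D - {w})" "sum b ?D = b w + sum b (?D - {w})"
      by (auto intro!: sum.remove)
    ultimately show ?case using assms[of w] by simp
  qed
qed

section \<open>The product of monomial basis elements\<close>

text \<open>Replaces the supports by index sets that depend only on \<open>p\<close> and
  \<open>q\<close>, ready for exchanging sums.\<close>

lemma yprod_M:
  assumes "s \<in> Y p" "t \<in> Y q"
  shows "yprod (M s) (M t) u = (\<Sum>s' \<in> Y p. \<Sum>t' \<in> Y q. M s s' * M t t' * Fprod s' t' u)"
proof -
  have supp: "{x. M r x \<noteq> 0} \<subseteq> Y n" if "r \<in> Y n" for r n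
    using that tamari_le_nodes by (auto simp: M_eq Y_def split: if_splits)
  have "yprod (M s) (M t) u = (\<Sum>s' \<in> {x. M s x \<noteq> 0}. \<Sum>t' \<in> Y q. M s s' * M t t' * Fprod s' t' u)"
    unfolding yprod_def using supp[OF assms(2)]
    by (intro sum.cong refl sum.mono_neutral_left) auto
  also have "\<dots> = (\<Sum>s' \<in> Y p. \<Sum>t' \<in> Y q. M s s' * M t t' * Fprod s' t' u)"
    using supp[OF assms(1)] by (intro sum.mono_neutral_left) auto
  finally show ?thesis .
qed

lemma sum_Fprod_below:
  assumes "s \<in> Y p" "t \<in> Y q"
  shows "(\<Sum>u \<in> {u. tamari_le u w}. Fprod s t u) =
    (\<Sum>\<zeta> \<in> Sh p q. if tamari_le (f_zeta \<zeta> s t) w then 1 else 0)"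
proof -
  have "(\<Sum>u \<in> {u. tamari_le u w}. Fprod s t u) =
      (\<Sum>u \<in> {u. tamari_le u w}. \<Sum>\<zeta> \<in> Sh p q. if u = f_zeta \<zeta> s t then 1 else 0)"
    unfolding Fprod_eq_card[OF assms]
    by (intro sum.cong refl) (simp add: sum.If_cases eq_commute Int_def)
  also have "\<dots> = (\<Sum>\<zeta> \<in> Sh p q. \<Sum>u \<in> {u. tamari_le u w}. if u = f_zeta \<zeta> s t then 1 else 0)"
    by (rule sum.swap)
  finally show ?thesis by simp
qed

text \<open>Over a product of principal ideals the double sum factors, and
  \<open>sum_M_below\<close> evaluates each factor. If \<open>A\<close> is empty, the sum is empty
  and there is no maximum.\<close>

lemma sum_M_preimage:
  assumes "s \<in> Y p" "t \<in> Y q" "r \<in> Y (p + q)" "\<zeta> \<in> Sh p q"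
  defines "A \<equiv> {(s', t') \<in> Y p \<times> Y q. tamari_le (f_zeta \<zeta> s' t') r}"
  shows "(\<Sum>s' \<in> Y p. \<Sum>t' \<in> Y q. M s s' * M t t' * (if tamari_le (f_zeta \<zeta> s' t') r then 1 else 0)) =
    (if is_max_pair A (s, t) then 1 else 0)"
proof -
  have "(\<Sum>s' \<in> Y p. \<Sum>t' \<in> Y q. M s s' * M t t' * (if tamari_le (f_zeta \<zeta> s' t') r then 1 else 0)) =
      (\<Sum>(s', t') \<in> Y p \<times> Y q. M s s' * M t t' * (if tamari_le (f_zeta \<zeta> s' t') r then 1 else 0))"
    by (rule sum.cartesian_product)
  also have "\<dots> = (\<Sum>(s', t') \<in> A. M s s' * M t t')"
    by (intro sum.mono_neutral_cong_right) (auto simp: A_def split: if_splits)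
  also have "\<dots> = (if is_max_pair A (s, t) then 1 else 0)"
  proof (cases "A = {}")
    case True
    then show ?thesis by (simp add: is_max_pair_def)
  next
    case False
    then obtain m m' where A: "A = {s. tamari_le s m} \<times> {t. tamari_le t m'}"
      using f_zeta_preimage[OF assms(4,3)] unfolding A_def by blast
    have "(\<Sum>(s', t') \<in> A. M s s' * M t t') =
        (\<Sum>s' \<in> {s. tamari_le s m}. M s s') * (\<Sum>t' \<in> {t. tamari_le t m'}. M t t')"
      unfolding A by (simp add: sum_product sum.cartesian_product)
    also have "\<dots> = (if s = m \<and> t = m' then 1 else 0)"
      by (simp add: sum_M_below)
    also have "s = m \<and> t = m' \<longleftrightarrow> is_max_pair A (s, t)"
      unfolding A is_max_pair_def by (auto intro: tamari_le_antisym)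
    finally show ?thesis .
  qed
  finally show ?thesis .
qed

theorem theorem4p2:
  fixes p q :: nat and s t :: tree
  assumes "s \<in> Y p" and "t \<in> Y q"
  shows "yprod (M s) (M t) =
    (\<lambda>u. \<Sum>r\<in>Y (p + q).
       of_nat (card {\<zeta> \<in> Sh p q.
          is_max_pair {(s', t') \<in> Y p \<times> Y q. tamari_le (f_zeta \<zeta> s' t') r} (s, t)})
       * M r u)"
proof (rule eq_of_sums_below)
  fix w
  define c :: "tree \<Rightarrow> rat" where "c r = of_nat (card {\<zeta> \<in> Sh p q.
      is_max_pair {(s', t') \<in> Y p \<times> Y q. tamari_le (f_zeta \<zeta> s' t') r} (s, t)})" for r
  let ?D = "{u. tamari_le u w}"
  let ?le = "\<lambda>\<zeta> s' t'. if tamari_le (f_zeta \<zeta> s' t') w then 1 else 0 :: rat"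
  have "(\<Sum>u \<in> ?D. yprod (M s) (M t) u) =
      (\<Sum>s' \<in> Y p. \<Sum>u \<in> ?D. \<Sum>t' \<in> Y q. M s s' * M t t' * Fprod s' t' u)"
    unfolding yprod_M[OF assms] by (rule sum.swap)
  also have "\<dots> = (\<Sum>s' \<in> Y p. \<Sum>t' \<in> Y q. \<Sum>u \<in> ?D. M s s' * M t t' * Fprod s' t' u)"
    by (intro sum.cong refl sum.swap)
  also have "\<dots> = (\<Sum>s' \<in> Y p. \<Sum>t' \<in> Y q. \<Sum>\<zeta> \<in> Sh p q. M s s' * M t t' * ?le \<zeta> s' t')"
    by (intro sum.cong refl) (simp only: sum_distrib_left[symmetric] sum_Fprod_below)
  also have "\<dots> = (\<Sum>s' \<in> Y p. \<Sum>\<zeta> \<in> Sh p q. \<Sum>t' \<in> Y q. M s s' * M t t' * ?le \<zeta> s' t')"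
    by (intro sum.cong refl sum.swap)
  also have "\<dots> = (\<Sum>\<zeta> \<in> Sh p q. \<Sum>s' \<in> Y p. \<Sum>t' \<in> Y q. M s s' * M t t' * ?le \<zeta> s' t')"
    by (rule sum.swap)
  \<comment> \<open>The comparison runs over trees \<open>w\<close> of every size. Outside
    \<open>Y (p + q)\<close> no \<open>f_zeta \<zeta> s' t'\<close> is below \<open>w\<close>, as
    comparable trees have equally many nodes.\<close>
  also have "\<dots> = (if w \<in> Y (p + q) then c w else 0)"
  proof (cases "w \<in> Y (p + q)")
    case True
    have "(\<Sum>\<zeta> \<in> Sh p q. \<Sum>s' \<in> Y p. \<Sum>t' \<in> Y q. M s s' * M t t' * ?le \<zeta> s' t') =
       (\<Sum>\<zeta> \<in> Sh p q. if is_max_pair {(s', t') \<in> Y p \<times> Y q. tamari_le (f_zeta \<zeta> s' t') w} (s, t)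
          then 1 else 0)"
      by (intro sum.cong refl sum_M_preimage assms True)
    then show ?thesis using True by (simp add: c_def sum.If_cases Int_def)
  next
    case False
    have "\<not> tamari_le (f_zeta \<zeta> s' t') w" if "\<zeta> \<in> Sh p q" "s' \<in> Y p" "t' \<in> Y q" for \<zeta> s' t'
      using f_zeta_in_Y[OF that] False tamari_le_nodes by (auto simp: Y_def)
    then show ?thesis using False by simp
  qed
  \<comment> \<open>The inner sum is the indicator of \<open>r = w\<close>, so the outer sum picks
    out \<open>c w\<close>.\<close>
  also have "\<dots> = (\<Sum>r \<in> Y (p + q). c r * (\<Sum>u \<in> ?D. M r u))"
    by (simp add: sum_M_below if_distrib cong: if_cong)
  also have "\<dots> = (\<Sum>u \<in> ?D. \<Sum>r \<in> Y (p + q). c r * M r u)"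
    unfolding sum_distrib_left by (rule sum.swap)
  finally show "(\<Sum>u \<in> ?D. yprod (M s) (M t) u) = (\<Sum>u \<in> ?D. \<Sum>r \<in> Y (p + q).
      of_nat (card {\<zeta> \<in> Sh p q.
          is_max_pair {(s', t') \<in> Y p \<times> Y q. tamari_le (f_zeta \<zeta> s' t') r} (s, t)}) * M r u)"
    unfolding c_def .
qed

end
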